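(* Let $\bm\theta\in\bigcup_{m=1}^M\Theta_m$. The stopping time $\tau=\tau_\alpha$ of the proposed policy (described in the context, with threshold $\beta(n,\alpha)$) satisfies $$\limsup_{\alpha\to0}\frac{\mathbb{E}_{\bm\theta}[\tau]}{|\log\alpha|}\leq\frac1{D^*(\bm\theta)} .$$
   Context: **Model.** $\mathcal U=\{1,\dots,|\mathcal U|\}$ is a finite set of controls. For each $u\in\mathcal U$, observations under control $u$ follow a single-parameter exponential family with natural parameter set $\Psi_u\subset\mathbb R$; $\Omega=\Psi_1\times\dots\times\Psi_{|\mathcal U|}$. For $\bm\theta=(\theta_1,\dots,\theta_{|\mathcal U|})\in\Omega$, an observation under control $u$ has density (w.r.t. a common measure $\mu$) $p(y;\bm\theta,u)=h_u(y)\exp[\theta_uT_u(y)-A_u(\theta_u)]$, where $T_u$ is the statistic and $A_u$ the log-partition function (convex, infinitely differentiable on $\Psi_u$). $b_u(\kappa)=\sup_\theta(\kappa\theta-A_u(\theta))$ is the convex conjugate of $A_u$; the expectation parameter $\kappa=\dot A_u(\theta)$ and $\theta$ are related by $\theta=\dot b_u(\kappa)$ (dots denote derivatives). The KL divergence under control $u$ is $D_u(\bm\theta\|\bm\theta')=A_u(\theta'_u)-A_u(\theta_u)-\dot A_u(\theta_u)(\theta'_u-\theta_u)$. **Hypotheses.** $\mathcal M=\{1,\dots,M\}$; under hypothesis $m$, $\bm\theta\in\Theta_m\subset\Omega$. Let $\|\cdot\|$ be a norm on $\mathbb R^{|\mathcal U|}$ and $\Delta(\bm x,A)=\inf\{\|\bm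 x-\bm\theta'\|:\bm\theta'\in A\}$. Assume: (1) $\Theta_m=\bigcup_{i=1}^{x_m}\Gamma_m^{(i)}$ is a finite disjoint union; (2) each $\Gamma^{(i)}_m$ is convex and open in its own affine hull; (3) $\Gamma^{(i)}_{m_1}\cap\Gamma^{(j)}_{m_2}=\emptyset$ whenever $m_1\ne m_2$, for all $i,j$; (4) for all $m,i$ and all $\bm\theta\in\Gamma_m^{(i)}$, $\Delta(\bm\theta,\Gamma^{(j)}_{m'})>0$ whenever $m'\ne m$ or $j\ne i$. For $\bm\theta\in\bigcup_m\Theta_m$, $g(\bm\theta)=m$ if $\bm\theta\in\Theta_m$. Let $\mathcal P$ be the set of probability distributions on $\mathcal U$ and $$D^*(\bm\theta)=\sup_{\bm q\in\mathcal P}\ \inf_{\bm\theta'\in\bigcup_{m}\Theta_m\setminus\Theta_{g(\bm\theta)}}\ \sum_{u\in\mathcal U}q_uD_u(\bm\theta\|\bm\theta').$$ The supremum is attained; it is assumed that the hypothesis sets are such that the maximizer is unique, denoted $\bm q^*(\bm\theta)$. **Sampling.** At each time $k=1,2,\dots$ a control $U_k$ is selected and an observation $Y_k$ is obtained; given $U_k=u$, $Y_k$ has density $p(\cdot;\bm\theta,u)$, conditionally independently of the past. $\mathcal F_n=\sigma(U_1,Y_1,\dots,U_n,Y_n)$. $\mathbb P_{\bm\theta},\mathbb E_{\bm\theta}$ denote probability and expectation when the parameter vector is $\bm\theta$. A policy consists of controls $U_n$ ($\mathcal F_{n-1}$-measurable), a stopping time $\tau$, and an $\mathcal F_\tau$-measurable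 decision $\hat m\in\mathcal M$. **Proposed policy.** Let $N_u(n)=\sum_{k=1}^n\mathbf 1_{\{U_k=u\}}$, $S_u(n)=\sum_{k=1}^nT_u(Y_k)\mathbf 1_{\{U_k=u\}}$, and $\underline Y^u(n)=(Y_k:U_k=u,k\le n)$, with $p(\underline Y^u(n);\bm\theta,u)=\prod_{k\le n:U_k=u}p(Y_k;\bm\theta,u)$. Put $$Z_{i,j}(n)=\log\frac{\sup_{\bm\theta'\in\Theta_i}\prod_{u}p(\underline Y^u(n);\bm\theta',u)}{\sup_{\bm\theta''\in\Theta_j}\prod_{u}p(\underline Y^u(n);\bm\theta'',u)},\quad Z_i(n)=\min_{j\ne i}Z_{i,j}(n),\quad Z(n)=\max_{i\in\mathcal M}Z_i(n).$$ Global MLE: $\bm\theta^*(n)=\arg\max_{\bm\theta'\in\Omega}\prod_up(\underline Y^u(n);\bm\theta',u)$, i.e. $\theta^*_u(n)=\dot b_u(S_u(n)/N_u(n))$. *Recommendation:* $\hat r(n)\in\arg\min_{m\in\mathcal M}\Delta(\bm\theta^*(n),\Theta_m)$. *Plug-in estimate:* $\hat{\bm\theta}(n)\in\arg\min_{\bm\theta'\in\Theta_{\hat r(n)}}\|\bm\theta'-\bm\theta^*(n)\|$; if no minimizer exists, $\hat{\bm\theta}(n)\in\Theta_{\hat r(n)}$ is chosen with $\|\hat{\bm\theta}(n)-\bm\theta^*(n)\|\le\rho\,\Delta(\bm\theta^*(n),\Theta_{\hat r(n)})$, where $\rho>1$ is fixed. *Control law:* first, every control is selected once. Afterwards $U_{n+1}\in\arg\max_{u\in\mathcal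 U}\sum_{k=1}^nq_u^{\epsilon_k}(\hat{\bm\theta}(k))-N_u(n)$, where $\epsilon_k=\frac12(|\mathcal U|^2+k)^{-1/2}$ and $\bm q^\epsilon(\bm\theta)$ is an $L^\infty$ projection of $\bm q^*(\bm\theta)$ onto $\{\bm q\in\mathcal P:q_u\in[\epsilon,1]\ \forall u\}$ (for $k<|\mathcal U|$, where the MLE is not yet defined, $\hat{\bm\theta}(k)$ is an arbitrary fixed element of $\bigcup_m\Theta_m$). The control law does not depend on $\alpha$. *Stopping rule:* $\tau=\inf\{n\in\mathbb N:Z(n)\ge\beta(n,\alpha)\}$, with $\beta(n,\alpha)=v(n)+w(\alpha)$, $w(\alpha)=|\log\alpha|+\sqrt{4|\mathcal U||\log\alpha|}$, $$v(n)=C+\log\big(n(1+\log n)^{|\mathcal U|+2}\big)+\sqrt{4|\mathcal U|\log\big(n(1+\log n)^{|\mathcal U|+2}\big)},$$ $$C=2|\mathcal U|\sqrt{2\log\frac{2|\mathcal U|}{e}+\frac1{|\mathcal U|}\log\frac{2e^{|\mathcal U|+1}}{|\mathcal U|^{|\mathcal U|}}}+\log\frac{2e^{|\mathcal U|+1}}{|\mathcal U|^{|\mathcal U|}}.$$ *Decision:* $\hat m\in\arg\max_{m\in\mathcal M}Z_m(\tau)$. *)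

theory Defs
  imports "HOL-Probability.Probability"
begin

text \<open>The controls form the finite type \<open>'u\<close> and the hypotheses the finite type \<open>'m\<close>.\<close>

definition is_norm :: "('a::real_vector \<Rightarrow> real) \<Rightarrow> bool" where
  "is_norm N \<longleftrightarrow>
     (\<forall>x. 0 \<le> N x) \<and> (\<forall>x. N x = 0 \<longleftrightarrow> x = 0) \<and>
     (\<forall>c x. N (c *\<^sub>R x) = \<bar>c\<bar> * N x) \<and> (\<forall>x y. N (x + y) \<le> N x + N y)"

text \<open>Only used for nonempty \<open>A\<close>, where the set of distances is bounded below by \<open>0\<close>.\<close>

definition dist_to :: "('a::real_vector \<Rightarrow> real) \<Rightarrow> 'a \<Rightarrow> 'a set \<Rightarrow> real" where
  "dist_to N x A = (INF t\<in>A. N (x - t))"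

definition distributions :: "(real ^ 'u::finite) set" where
  "distributions = {q. (\<forall>u. 0 \<le> q $ u) \<and> (\<Sum>u\<in>UNIV. q $ u) = 1}"

locale exp_families =
  fixes \<mu> :: "'y measure"
    and h T :: "'u::finite \<Rightarrow> 'y \<Rightarrow> real"
  assumes h_measurable: "h u \<in> borel_measurable \<mu>"
    and h_nonneg: "y \<in> space \<mu> \<Longrightarrow> 0 \<le> h u y"
    and T_measurable: "T u \<in> borel_measurable \<mu>"
begin

definition partition_fun :: "'u \<Rightarrow> real \<Rightarrow> real" where
  "partition_fun u t = (\<integral>y. h u y * exp (t * T u y) \<partial>\<mu>)"

definition nat_params :: "'u \<Rightarrow> real set" where
  "nat_params u =
     {t. integrable \<mu> (\<lambda>y. h u y * exp (t * T u y)) \<and> 0 < partition_fun u t}"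

definition param_space :: "(real ^ 'u) set" where
  "param_space = {\<theta>. \<forall>u. \<theta> $ u \<in> nat_params u}"

definition log_partition :: "'u \<Rightarrow> real \<Rightarrow> real" where
  "log_partition u t = ln (partition_fun u t)"

definition obs_density :: "real ^ 'u \<Rightarrow> 'u \<Rightarrow> 'y \<Rightarrow> real" where
  "obs_density \<theta> u y = h u y * exp (\<theta> $ u * T u y - log_partition u (\<theta> $ u))"

text \<open>The conjugate is meaningful where the supremum is finite; it is only evaluated
  near points in the range of the derivative of the log-partition function.\<close>

definition conjugate :: "'u \<Rightarrow> real \<Rightarrow> real" where
  "conjugate u \<kappa> = (SUP t\<in>nat_params u. \<kappa> * t - log_partition u t)"

definition KL :: "'u \<Rightarrow> real ^ 'u \<Rightarrow> real ^ 'u \<Rightarrow> real" where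
  "KL u \<theta> \<theta>' = log_partition u (\<theta>' $ u) - log_partition u (\<theta> $ u)
     - deriv (log_partition u) (\<theta> $ u) * (\<theta>' $ u - \<theta> $ u)"

end

text \<open>
  Derivatives of the log-partition function are two-sided, so its smoothness on the natural
  parameter set is understood on an open set. The relation between natural and expectation
  parameters rules out families in which the statistic is almost everywhere constant.
\<close>

locale regular_exp_families = exp_families \<mu> h T
  for \<mu> :: "'y measure" and h T :: "'u::finite \<Rightarrow> 'y \<Rightarrow> real" +
  assumes nat_params_open: "open (nat_params u)"
    and log_partition_convex: "convex_on (nat_params u) (log_partition u)"
    and log_partition_smooth:
      "t \<in> nat_params u \<Longrightarrow> (deriv ^^ k) (log_partition u) differentiable (at t)"
    and dual_param:
      "t \<in> nat_params u \<Longrightarrow>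
         (conjugate u has_real_derivative t) (at (deriv (log_partition u) t))"

text \<open>Hypothesis \<open>m\<close> is the disjoint union of the pieces \<open>\<Gamma> m 1, \<dots>, \<Gamma> m (npieces m)\<close>.\<close>

locale hypothesis_sets = regular_exp_families \<mu> h T
  for \<mu> :: "'y measure" and h T :: "'u::finite \<Rightarrow> 'y \<Rightarrow> real" +
  fixes nrm :: "real ^ 'u \<Rightarrow> real"
    and npieces :: "'m::finite \<Rightarrow> nat"
    and \<Gamma> :: "'m \<Rightarrow> nat \<Rightarrow> (real ^ 'u) set"
  assumes nrm: "is_norm nrm"
    and npieces_pos: "1 \<le> npieces m"
    and pieces_nonempty: "i \<in> {1..npieces m} \<Longrightarrow> \<Gamma> m i \<noteq> {}"
    and pieces_in_param_space: "i \<in> {1..npieces m} \<Longrightarrow> \<Gamma> m i \<subseteq> param_space"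
    and pieces_disjoint:
      "i \<in> {1..npieces m} \<Longrightarrow> j \<in> {1..npieces m} \<Longrightarrow> i \<noteq> j \<Longrightarrow> \<Gamma> m i \<inter> \<Gamma> m j = {}"
    and pieces_convex: "i \<in> {1..npieces m} \<Longrightarrow> convex (\<Gamma> m i)"
    and pieces_rel_open:
      "i \<in> {1..npieces m} \<Longrightarrow> openin (top_of_set (affine hull \<Gamma> m i)) (\<Gamma> m i)"
    and hyps_disjoint:
      "i \<in> {1..npieces m} \<Longrightarrow> j \<in> {1..npieces m'} \<Longrightarrow> m \<noteq> m' \<Longrightarrow> \<Gamma> m i \<inter> \<Gamma> m' j = {}"
    and pieces_separated:
      "i \<in> {1..npieces m} \<Longrightarrow> j \<in> {1..npieces m'} \<Longrightarrow> \<theta> \<in> \<Gamma> m i \<Longrightarrow> m' \<noteq> m \<or> j \<noteq> i \<Longrightarrow>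
         0 < dist_to nrm \<theta> (\<Gamma> m' j)"
begin

definition \<Theta> :: "'m \<Rightarrow> (real ^ 'u) set" where
  "\<Theta> m = (\<Union>i\<in>{1..npieces m}. \<Gamma> m i)"

definition g :: "real ^ 'u \<Rightarrow> 'm" where
  "g \<theta> = (THE m. \<theta> \<in> \<Theta> m)"

definition info :: "real ^ 'u \<Rightarrow> real ^ 'u \<Rightarrow> ereal" where
  "info \<theta> q = (INF \<theta>'\<in>(\<Union>m. \<Theta> m) - \<Theta> (g \<theta>). ereal (\<Sum>u\<in>UNIV. q $ u * KL u \<theta> \<theta>'))"

definition D_star :: "real ^ 'u \<Rightarrow> ereal" where
  "D_star \<theta> = (SUP q\<in>distributions. info \<theta> q)"

definition q_star :: "real ^ 'u \<Rightarrow> real ^ 'u" where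
  "q_star \<theta> = (THE q. q \<in> distributions \<and> info \<theta> q = D_star \<theta>)"

end

text \<open>The sigma-algebra generated by the first \<open>n\<close> controls and observations
  (trivial for \<open>n = 0\<close>).\<close>

definition history ::
    "'w measure \<Rightarrow> 'y measure \<Rightarrow> (nat \<Rightarrow> 'w \<Rightarrow> 'u) \<Rightarrow> (nat \<Rightarrow> 'w \<Rightarrow> 'y) \<Rightarrow> nat \<Rightarrow> 'w measure"
  where
  "history P \<mu> U Y n = sigma (space P)
     {(\<lambda>w. (U k w, Y k w)) -` B \<inter> space P | k B.
        k \<in> {1..n} \<and> B \<in> sets (count_space UNIV \<Otimes>\<^sub>M \<mu>)}"

text \<open>
  \<open>P\<close> is the law under the parameter vector \<open>\<theta>\<close>; times are indexed from \<open>1\<close>. The last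
  assumption says that, given \<open>U n = u\<close>, the observation \<open>Y n\<close> has density
  \<open>obs_density \<theta> u\<close> and is conditionally independent of the past.
\<close>

locale controlled_sampling = hypothesis_sets \<mu> h T nrm npieces \<Gamma>
  for \<mu> :: "'y measure" and h T :: "'u::finite \<Rightarrow> 'y \<Rightarrow> real"
    and nrm :: "real ^ 'u \<Rightarrow> real" and npieces :: "'m::finite \<Rightarrow> nat"
    and \<Gamma> :: "'m \<Rightarrow> nat \<Rightarrow> (real ^ 'u) set" +
  fixes \<theta> :: "real ^ 'u"
    and P :: "'w measure"
    and U :: "nat \<Rightarrow> 'w \<Rightarrow> 'u"
    and Y :: "nat \<Rightarrow> 'w \<Rightarrow> 'y"
  assumes prob_space_P: "prob_space P"
    and Y_measurable: "1 \<le> n \<Longrightarrow> Y n \<in> measurable P \<mu>"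
    and U_measurable: "1 \<le> n \<Longrightarrow> U n \<in> measurable P (count_space UNIV)"
    and U_predictable:
      "1 \<le> n \<Longrightarrow> U n \<in> measurable (history P \<mu> U Y (n - 1)) (count_space UNIV)"
    and Y_conditional_law:
      "1 \<le> n \<Longrightarrow> G \<in> sets (history P \<mu> U Y (n - 1)) \<Longrightarrow> B \<in> sets \<mu> \<Longrightarrow>
         emeasure P (G \<inter> {w \<in> space P. U n w = u \<and> Y n w \<in> B}) =
         emeasure P (G \<inter> {w \<in> space P. U n w = u}) *
         emeasure (density \<mu> (\<lambda>y. ennreal (obs_density \<theta> u y))) B"
begin

definition N :: "'u \<Rightarrow> nat \<Rightarrow> 'w \<Rightarrow> nat" where
  "N u n w = card {k \<in> {1..n}. U k w = u}"

definition lik :: "nat \<Rightarrow> 'w \<Rightarrow> real ^ 'u \<Rightarrow> real" where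
  "lik n w \<theta>' = (\<Prod>u\<in>UNIV. \<Prod>k\<in>{k \<in> {1..n}. U k w = u}. obs_density \<theta>' u (Y k w))"

text \<open>Almost surely all likelihoods are positive and bounded in the parameter,
  so the real suprema and the logarithm are proper.\<close>

definition Zpair :: "'m \<Rightarrow> 'm \<Rightarrow> nat \<Rightarrow> 'w \<Rightarrow> real" where
  "Zpair i j n w = ln ((SUP \<theta>'\<in>\<Theta> i. lik n w \<theta>') / (SUP \<theta>''\<in>\<Theta> j. lik n w \<theta>''))"

definition Zhyp :: "'m \<Rightarrow> nat \<Rightarrow> 'w \<Rightarrow> ereal" where
  "Zhyp i n w = (INF j\<in>UNIV - {i}. ereal (Zpair i j n w))"

definition Z :: "nat \<Rightarrow> 'w \<Rightarrow> ereal" where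
  "Z n w = (SUP i\<in>UNIV. Zhyp i n w)"

end

text \<open>Threshold constants, with \<open>K\<close> the number of controls.\<close>

definition thr_C :: "nat \<Rightarrow> real" where
  "thr_C K =
     2 * real K * sqrt (2 * ln (2 * real K / exp 1)
                        + 1 / real K * ln (2 * exp (real K + 1) / real K ^ K))
     + ln (2 * exp (real K + 1) / real K ^ K)"

definition thr_v :: "nat \<Rightarrow> nat \<Rightarrow> real" where
  "thr_v K n =
     thr_C K + ln (real n * (1 + ln (real n)) ^ (K + 2))
     + sqrt (4 * real K * ln (real n * (1 + ln (real n)) ^ (K + 2)))"

definition thr_w :: "nat \<Rightarrow> real \<Rightarrow> real" where
  "thr_w K \<alpha> = \<bar>ln \<alpha>\<bar> + sqrt (4 * real K * \<bar>ln \<alpha>\<bar>)"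

definition threshold :: "nat \<Rightarrow> nat \<Rightarrow> real \<Rightarrow> real" where
  "threshold K n \<alpha> = thr_v K n + thr_w K \<alpha>"

definition explore_eps :: "nat \<Rightarrow> nat \<Rightarrow> real" where
  "explore_eps K k = 1 / 2 * (real K ^ 2 + real k) powr (- 1 / 2)"

text \<open>
  The set of feasible distributions in \<open>q_eps_projection\<close> is nonempty exactly for
  \<open>\<epsilon> \<le> 1 / CARD('u)\<close>, and \<open>infnorm\<close> is the maximum norm on \<open>real ^ 'u\<close>.
  \<open>mle\<close> is the global maximum likelihood estimate; where the likelihood has no maximizer (as
  for a Bernoulli sample of zeros) its value is left arbitrary. All tie-breaking choices
  are arbitrary. None of the fixed data depend on the error level \<open>\<alpha>\<close>, which enters through
  the stopping time only.
\<close>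

locale proposed_policy = controlled_sampling \<mu> h T nrm npieces \<Gamma> \<theta> P U Y
  for \<mu> :: "'y measure" and h T :: "'u::finite \<Rightarrow> 'y \<Rightarrow> real"
    and nrm :: "real ^ 'u \<Rightarrow> real" and npieces :: "'m::finite \<Rightarrow> nat"
    and \<Gamma> :: "'m \<Rightarrow> nat \<Rightarrow> (real ^ 'u) set"
    and \<theta> :: "real ^ 'u" and P :: "'w measure"
    and U :: "nat \<Rightarrow> 'w \<Rightarrow> 'u" and Y :: "nat \<Rightarrow> 'w \<Rightarrow> 'y" +
  fixes \<rho> :: real
    and q_eps :: "real \<Rightarrow> real ^ 'u \<Rightarrow> real ^ 'u"
    and mle plug_in :: "nat \<Rightarrow> 'w \<Rightarrow> real ^ 'u"
    and rec :: "nat \<Rightarrow> 'w \<Rightarrow> 'm"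
    and init :: "nat \<Rightarrow> real ^ 'u"
  assumes q_star_unique:
      "\<theta>' \<in> (\<Union>m. \<Theta> m) \<Longrightarrow> \<exists>!q. q \<in> distributions \<and> info \<theta>' q = D_star \<theta>'"
    and q_eps_projection:
      "\<theta>' \<in> (\<Union>m. \<Theta> m) \<Longrightarrow> 0 < \<epsilon> \<Longrightarrow> \<epsilon> \<le> 1 / real CARD('u) \<Longrightarrow>
         is_arg_min (\<lambda>q. infnorm (q - q_star \<theta>'))
           (\<lambda>q. q \<in> distributions \<and> (\<forall>u. q $ u \<in> {\<epsilon>..1})) (q_eps \<epsilon> \<theta>')"
    and rho_gt_1: "1 < \<rho>"
    and mle:
      "CARD('u) \<le> n \<Longrightarrow> w \<in> space P \<Longrightarrow>
         \<exists>t. is_arg_max (lik n w) (\<lambda>t. t \<in> param_space) t \<Longrightarrow>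
         is_arg_max (lik n w) (\<lambda>t. t \<in> param_space) (mle n w)"
    and recommendation:
      "CARD('u) \<le> n \<Longrightarrow> w \<in> space P \<Longrightarrow>
         is_arg_min (\<lambda>m. dist_to nrm (mle n w) (\<Theta> m)) (\<lambda>_. True) (rec n w)"
    and plug_in_minimizer:
      "CARD('u) \<le> n \<Longrightarrow> w \<in> space P \<Longrightarrow>
         \<exists>t. is_arg_min (\<lambda>t. nrm (t - mle n w)) (\<lambda>t. t \<in> \<Theta> (rec n w)) t \<Longrightarrow>
         is_arg_min (\<lambda>t. nrm (t - mle n w)) (\<lambda>t. t \<in> \<Theta> (rec n w)) (plug_in n w)"
    and plug_in_no_minimizer:
      "CARD('u) \<le> n \<Longrightarrow> w \<in> space P \<Longrightarrow>
         \<nexists>t. is_arg_min (\<lambda>t. nrm (t - mle n w)) (\<lambda>t. t \<in> \<Theta> (rec n w)) t \<Longrightarrow>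
         plug_in n w \<in> \<Theta> (rec n w) \<and>
         nrm (plug_in n w - mle n w) \<le> \<rho> * dist_to nrm (mle n w) (\<Theta> (rec n w))"
    and init_in: "init k \<in> (\<Union>m. \<Theta> m)"
    and plug_in_init: "k < CARD('u) \<Longrightarrow> w \<in> space P \<Longrightarrow> plug_in k w = init k"
    and initial_controls: "w \<in> space P \<Longrightarrow> bij_betw (\<lambda>k. U k w) {1..CARD('u)} UNIV"
    and control_law:
      "CARD('u) \<le> n \<Longrightarrow> w \<in> space P \<Longrightarrow>
         is_arg_max
           (\<lambda>u. (\<Sum>k=1..n. q_eps (explore_eps CARD('u) k) (plug_in k w) $ u) - real (N u n w))
           (\<lambda>_. True) (U (n + 1) w)"
begin

definition \<tau> :: "real \<Rightarrow> 'w \<Rightarrow> enat" where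
  "\<tau> \<alpha> w = Inf {enat n | n. 1 \<le> n \<and> ereal (threshold CARD('u) n \<alpha>) \<le> Z n w}"

definition expected_time :: "real \<Rightarrow> ennreal" where
  "expected_time \<alpha> = (\<integral>\<^sup>+w. ennreal_of_enat (\<tau> \<alpha> w) \<partial>P)"

end

end

theory Submission
  imports Defs "HOL-Real_Asymp.Real_Asymp"
begin

text \<open>
  The log-likelihood ratio of \<open>\<theta>\<close> against \<open>t\<close> at time \<open>n\<close> is
  \<open>\<Sum>\<^sub>u N\<^sub>u KL\<^sub>u(\<theta>, t)\<close> up to a noise term linear in \<open>t - \<theta>\<close>. As \<open>KL\<^sub>u\<close> itself grows at
  least linearly in \<open>t - \<theta>\<close>, small deviations of the empirical means, as well as small
  changes of \<open>\<theta>\<close> inside \<open>KL\<^sub>u\<close>, cost only a factor \<open>1 - s\<close> and a summand \<open>s\<close>, uniformly over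
  the unbounded set of alternatives. Hence \<open>q\<^sup>*\<close> is continuous at \<open>\<theta>\<close> along its hypothesis
  (uniqueness of the maximizer and compactness of the simplex), and once the empirical
  means stay near the true ones, the tracking rule makes \<open>Z n\<close> grow at least like \<open>n d\<close>
  for any \<open>d < D\<^sup>*\<close>. This holds from a constant multiple of \<open>1 + R\<close> on, where \<open>R\<close> is the sum of
  all times at which some empirical mean deviates. Forced exploration and a Chernoff bound make
  \<open>R\<close> integrable; it does not depend on \<open>\<alpha>\<close> and so disappears after division by \<open>|log \<alpha>|\<close>.
\<close>

section \<open>Regular exponential families\<close>

text \<open>Strict monotonicity of \<open>mean u\<close> is the single source of the linear growth
  of the divergence, of the uniqueness of the maximum likelihood estimate and, with the intermediate
  value theorem, of its existence near \<open>\<theta>\<close>; second derivatives never appear. The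
  obstacle in the concentration step is that the number of pulls of a control is random and depends
  on the observations, so a Chernoff bound for a fixed sample size does not apply. An exponential
  martingale carries the count in its exponent, and forced exploration bounds the count from below
  by a deterministic quantity of order sqrt n; the resulting tails exp(-c sqrt n) are summable even
  against the weight n. Since divergences are nonnegative, only lower bounds on the pulls are
  needed, and controls of optimal proportion zero require nothing. Information is compared with real
  levels \<open>d\<close> below \<open>D_star \<theta>\<close>, so that an infinite
  \<open>D_star \<theta>\<close> needs no separate treatment before the last limit.\<close>

context regular_exp_families
begin

abbreviation mean :: "'u \<Rightarrow> real \<Rightarrow> real" where
  "mean u \<equiv> deriv (log_partition u)"

text \<open>Besides being the divergence in one coordinate, this is the log moment generating
  function, at tilt \<open>t - s\<close>, of the centred statistic under \<open>s\<close>; the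
  Chernoff bound relies on that reading.\<close>

definition bregman :: "'u \<Rightarrow> real \<Rightarrow> real \<Rightarrow> real" where
  "bregman u s t = log_partition u t - log_partition u s - mean u s * (t - s)"

lemma KL_eq_bregman: "KL u \<theta> \<theta>' = bregman u (\<theta> $ u) (\<theta>' $ u)"
  by (simp add: KL_def bregman_def)

lemma log_partition_has_derivative:
  assumes "t \<in> nat_params u"
  shows "(log_partition u has_real_derivative mean u t) (at t)"
  using log_partition_smooth[OF assms, of 0] by (simp add: DERIV_deriv_iff_real_differentiable)

lemma isCont_log_partition: "t \<in> nat_params u \<Longrightarrow> isCont (log_partition u) t"
  using log_partition_has_derivative DERIV_isCont by blast

lemma isCont_mean: "t \<in> nat_params u \<Longrightarrow> isCont (mean u) t"
  using log_partition_smooth[of t u 1] by (simp add: differentiable_imp_continuous_within)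

lemma nat_params_convex: "convex (nat_params u)"
  using log_partition_convex by (simp add: convex_on_def)

lemma bregman_nonneg:
  assumes "s \<in> nat_params u" "t \<in> nat_params u"
  shows "0 \<le> bregman u s t"
proof -
  have "log_partition u t - log_partition u s \<ge> mean u s * (t - s)"
    using assms nat_params_open log_partition_has_derivative
    by (intro convex_on_imp_above_tangent[OF log_partition_convex])
       (auto simp: interior_open convex_connected nat_params_convex has_field_derivative_at_within)
  then show ?thesis by (simp add: bregman_def)
qed

text \<open>The conjugate has derivative \<open>t\<close> at \<open>mean u t\<close>, so a parameter
  can be recovered from its mean. Here the families with an almost everywhere constant statistic are
  excluded.\<close>

lemma mean_inj: "inj_on (mean u) (nat_params u)"
proof (rule inj_onI)
  fix s t assume "s \<in> nat_params u" "t \<in> nat_params u" "mean u s = mean u t"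
  then have "(conjugate u has_real_derivative s) (at (mean u t))"
    using dual_param[of s u] by simp
  then show "s = t" using dual_param[OF \<open>t \<in> nat_params u\<close>] by (rule DERIV_unique)
qed

text \<open>Adding the tangent inequalities at \<open>s\<close> and at \<open>t\<close> gives weak
  monotonicity; injectivity makes it strict.\<close>

lemma mean_strict_mono:
  assumes "s \<in> nat_params u" "t \<in> nat_params u" "s < t"
  shows "mean u s < mean u t"
proof -
  have "mean u s * (t - s) \<le> mean u t * (t - s)"
    using bregman_nonneg[OF assms(1,2)] bregman_nonneg[OF assms(2,1)]
    by (simp add: bregman_def algebra_simps)
  then have "mean u s \<le> mean u t" using assms(3) by simp
  moreover have "mean u s \<noteq> mean u t"
    using mean_inj assms by (metis inj_onD less_irrefl)
  ultimately show ?thesis by simp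
qed

text \<open>The three-point identity of Bregman divergences. For \<open>r\<close> between
  \<open>s\<close> and \<open>t\<close> all three summands are nonnegative, so each of them alone is
  a lower bound.\<close>

lemma bregman_three_point:
  "bregman u s t = bregman u s r + bregman u r t + (mean u r - mean u s) * (t - r)"
  by (simp add: bregman_def algebra_simps)

lemma bregman_pos:
  assumes "s \<in> nat_params u" "t \<in> nat_params u" "s \<noteq> t"
  shows "0 < bregman u s t"
proof -
  define r where "r = (s + t) / 2"
  have r: "r \<in> nat_params u"
    using convexD[OF nat_params_convex assms(1,2), of "1/2" "1/2"]
    by (simp add: r_def field_simps)
  have "0 < (mean u r - mean u s) * (t - r)"
  proof (cases "s < t")
    case True
    then show ?thesis using mean_strict_mono[OF assms(1) r]
      by (intro mult_pos_pos) (simp_all add: r_def field_simps)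
  next
    case False
    then have "t < s" using assms(3) by simp
    then show ?thesis using mean_strict_mono[OF r assms(1)]
      by (intro mult_neg_neg) (simp_all add: r_def field_simps)
  qed
  then show ?thesis
    using bregman_three_point[of u s t r] bregman_nonneg[OF assms(1) r] bregman_nonneg[OF r assms(2)]
    by linarith
qed

lemma nat_params_neighbours:
  assumes "s \<in> nat_params u" "0 < \<epsilon>"
  obtains r where "0 < r" "r < \<epsilon>" "\<And>t. \<bar>t - s\<bar> \<le> r \<Longrightarrow> t \<in> nat_params u"
proof -
  obtain e where e: "e > 0" "cball s e \<subseteq> nat_params u"
    using nat_params_open assms(1) open_contains_cball by blast
  show ?thesis
    by (rule that[of "min e (\<epsilon> / 2)"])
       (use e assms(2) in \<open>auto simp: cball_def dist_real_def subset_iff abs_minus_commute\<close>)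
qed

text \<open>To the right of \<open>s + r\<close> the three-point identity with middle point
  \<open>s + r\<close> leaves a cross term of positive slope
  \<open>mean u (s + r) - mean u s\<close>; the left side is symmetric. The 1 on the right-hand side
  is for \<open>t\<close> close to \<open>s\<close>, where the divergence may be far smaller than
  the distance.\<close>

lemma bregman_growth:
  assumes s: "s \<in> nat_params u"
  obtains c where "0 < c" "\<And>t. t \<in> nat_params u \<Longrightarrow> \<bar>t - s\<bar> \<le> c * (1 + bregman u s t)"
proof -
  obtain r where r: "0 < r" and in_nat: "\<And>t. \<bar>t - s\<bar> \<le> r \<Longrightarrow> t \<in> nat_params u"
    using nat_params_neighbours[OF s zero_less_one] by metis
  have plus: "s + r \<in> nat_params u" and minus: "s - r \<in> nat_params u"
    using in_nat r by auto
  define a where "a = min (mean u (s + r) - mean u s) (mean u s - mean u (s - r))"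
  have a: "0 < a" using mean_strict_mono[OF s plus] mean_strict_mono[OF minus s] r by (simp add: a_def)
  have lin: "a * (\<bar>t - s\<bar> - r) \<le> bregman u s t" if t: "t \<in> nat_params u" for t
  proof -
    consider "t > s + r" | "t < s - r" | "\<bar>t - s\<bar> \<le> r" by linarith
    then show ?thesis
    proof cases
      case 1
      have "a * (t - (s + r)) \<le> (mean u (s + r) - mean u s) * (t - (s + r))"
        using 1 by (intro mult_right_mono) (auto simp: a_def)
      then show ?thesis
        using 1 r bregman_three_point[of u s t "s + r"] bregman_nonneg[OF s plus] bregman_nonneg[OF plus t]
        by (simp add: abs_of_pos algebra_simps)
    next
      case 2
      have "a * ((s - r) - t) \<le> (mean u s - mean u (s - r)) * ((s - r) - t)"
        using 2 by (intro mult_right_mono) (auto simp: a_def)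
      then show ?thesis
        using 2 r bregman_three_point[of u s t "s - r"] bregman_nonneg[OF s minus] bregman_nonneg[OF minus t]
        by (simp add: abs_of_neg algebra_simps)
    next
      case 3
      then have "a * (\<bar>t - s\<bar> - r) \<le> 0" using a by (simp add: mult_nonneg_nonpos)
      then show ?thesis using bregman_nonneg[OF s t] by linarith
    qed
  qed
  have "\<bar>t - s\<bar> \<le> (1 / a + r) * (1 + bregman u s t)" if t: "t \<in> nat_params u" for t
  proof -
    have "\<bar>t - s\<bar> \<le> bregman u s t / a + r" using lin[OF t] a by (simp add: field_simps)
    also have "\<dots> \<le> (1 / a + r) * (1 + bregman u s t)"
      using a r bregman_nonneg[OF s t] by (simp add: field_simps)
    finally show ?thesis .
  qed
  moreover have "0 < 1 / a + r" using a r by (intro add_pos_pos) auto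
  ultimately show ?thesis using that by blast
qed

text \<open>The nonlinear term \<open>log_partition u t\<close> cancels in the difference, which is
  therefore affine in \<open>t - s\<close> with coefficients vanishing as \<open>s'\<close> tends to
  \<open>s\<close>. Linear growth converts this into a relative error, uniform in
  \<open>t\<close>.\<close>

lemma bregman_perturb:
  assumes s: "s \<in> nat_params u" and "0 < \<epsilon>"
  shows "\<forall>\<^sub>F s' in nhds s. \<forall>t\<in>nat_params u.
           \<bar>bregman u s' t - bregman u s t\<bar> \<le> \<epsilon> * (1 + bregman u s t)"
proof -
  obtain c where c: "0 < c" "\<And>t. t \<in> nat_params u \<Longrightarrow> \<bar>t - s\<bar> \<le> c * (1 + bregman u s t)"
    using bregman_growth[OF s] by metis
  define f where "f s' = \<bar>log_partition u s - log_partition u s' + mean u s' * (s' - s)\<bar>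
    + c * \<bar>mean u s' - mean u s\<bar>" for s'
  have "isCont f s"
    unfolding f_def using isCont_log_partition[OF s] isCont_mean[OF s]
    by (intro continuous_intros) auto
  then have "(f \<longlongrightarrow> f s) (nhds s)"
    by (simp add: isCont_def tendsto_at_iff_tendsto_nhds)
  moreover have "f s = 0" by (simp add: f_def)
  ultimately have "\<forall>\<^sub>F s' in nhds s. f s' < \<epsilon>"
    using assms(2) by (simp add: order_tendstoD(2))
  then show ?thesis
  proof eventually_elim
    case (elim s')
    show ?case
    proof
      fix t assume t: "t \<in> nat_params u"
      have b: "0 \<le> bregman u s t" by (rule bregman_nonneg[OF s t])
      let ?x = "\<bar>log_partition u s - log_partition u s' + mean u s' * (s' - s)\<bar>"
      have "bregman u s' t - bregman u s t =
          (log_partition u s - log_partition u s' + mean u s' * (s' - s)) - (mean u s' - mean u s) * (t - s)"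
        by (simp add: bregman_def algebra_simps)
      then have "\<bar>bregman u s' t - bregman u s t\<bar> \<le> ?x + \<bar>mean u s' - mean u s\<bar> * \<bar>t - s\<bar>"
        by (metis abs_mult abs_triangle_ineq4)
      also have "\<dots> \<le> ?x * (1 + bregman u s t) + \<bar>mean u s' - mean u s\<bar> * (c * (1 + bregman u s t))"
        using c(2)[OF t] b by (intro add_mono mult_left_mono) (auto simp: algebra_simps)
      also have "\<dots> = f s' * (1 + bregman u s t)" by (simp add: f_def algebra_simps)
      also have "\<dots> \<le> \<epsilon> * (1 + bregman u s t)" using elim b by (intro mult_right_mono) auto
      finally show "\<bar>bregman u s' t - bregman u s t\<bar> \<le> \<epsilon> * (1 + bregman u s t)" .
    qed
  qed
qed

text \<open>The intermediate value theorem for \<open>mean u\<close> on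
  \<open>[s - r, s + r]\<close>. It solves the likelihood equation in one coordinate without
  evaluating \<open>conjugate\<close>.\<close>

lemma maximizer_near:
  assumes s: "s \<in> nat_params u" and "0 < \<epsilon>"
  obtains \<eta> where "0 < \<eta>"
    "\<And>\<kappa>. \<bar>\<kappa> - mean u s\<bar> < \<eta> \<Longrightarrow> \<exists>t\<in>nat_params u. \<bar>t - s\<bar> < \<epsilon> \<and> mean u t = \<kappa>"
proof -
  obtain r where r: "0 < r" "r < \<epsilon>" and in_nat: "\<And>t. \<bar>t - s\<bar> \<le> r \<Longrightarrow> t \<in> nat_params u"
    using nat_params_neighbours[OF assms] by metis
  have plus: "s + r \<in> nat_params u" and minus: "s - r \<in> nat_params u"
    using in_nat r by auto
  define \<eta> where "\<eta> = min (mean u (s + r) - mean u s) (mean u s - mean u (s - r))"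
  have "0 < \<eta>" using mean_strict_mono[OF s plus] mean_strict_mono[OF minus s] r by (simp add: \<eta>_def)
  moreover have "\<exists>t\<in>nat_params u. \<bar>t - s\<bar> < \<epsilon> \<and> mean u t = \<kappa>" if "\<bar>\<kappa> - mean u s\<bar> < \<eta>" for \<kappa>
  proof -
    have "mean u (s - r) \<le> \<kappa>" "\<kappa> \<le> mean u (s + r)" using that by (auto simp: \<eta>_def abs_less_iff)
    then obtain t where "s - r \<le> t" "t \<le> s + r" "mean u t = \<kappa>"
      using IVT[of "mean u" "s - r" \<kappa> "s + r"] r isCont_mean in_nat by fastforce
    then show ?thesis using in_nat[of t] r by (intro bexI[of _ t]) auto
  qed
  ultimately show ?thesis using that by blast
qed

text \<open>Here \<open>l\<close> is the tilt and \<open>I\<close> the exponent of the later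
  Chernoff bound. The divergence is at most its symmetrization
  \<open>(mean u t - mean u s) * (t - s)\<close>, and for small \<open>l\<close> continuity of
  \<open>mean u\<close> keeps this strictly below \<open>l * \<eta>\<close>.\<close>

lemma chernoff_rate:
  assumes s: "s \<in> nat_params u" and "0 < \<eta>"
  obtains l I where "0 < l" "0 < I" "s + l \<in> nat_params u" "s - l \<in> nat_params u"
    "bregman u s (s + l) \<le> l * \<eta> - I" "bregman u s (s - l) \<le> l * \<eta> - I"
proof -
  have "\<forall>\<^sub>F t in nhds s. \<bar>mean u t - mean u s\<bar> < \<eta>"
    using isCont_mean[OF s] assms(2) unfolding isCont_def tendsto_at_iff_tendsto_nhds
    by (auto dest!: tendstoD simp: dist_real_def)
  then obtain d where d: "0 < d" "\<And>t. \<bar>t - s\<bar> < d \<Longrightarrow> \<bar>mean u t - mean u s\<bar> < \<eta>"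
    unfolding eventually_nhds_metric dist_real_def by blast
  obtain l where l: "0 < l" "l < d" "\<And>t. \<bar>t - s\<bar> \<le> l \<Longrightarrow> t \<in> nat_params u"
    using nat_params_neighbours[OF s d(1)] by metis
  have plus: "s + l \<in> nat_params u" and minus: "s - l \<in> nat_params u" using l by auto
  have below: "bregman u s t < l * \<eta>" if t: "\<bar>t - s\<bar> = l" for t
  proof -
    have "bregman u s t + bregman u t s = (mean u t - mean u s) * (t - s)"
      by (simp add: bregman_def algebra_simps)
    also have "\<dots> \<le> \<bar>mean u t - mean u s\<bar> * l" using t by (metis abs_ge_self abs_mult)
    also have "\<dots> < \<eta> * l" using d(2)[of t] t l by (intro mult_strict_right_mono) auto
    finally show ?thesis using bregman_nonneg[of t u s] s l(3)[of t] t by (simp add: mult.commute)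
  qed
  define I where "I = l * \<eta> - max (bregman u s (s + l)) (bregman u s (s - l))"
  have "0 < I" using below[of "s + l"] below[of "s - l"] l(1) by (simp add: I_def)
  moreover have "bregman u s (s + l) \<le> l * \<eta> - I" "bregman u s (s - l) \<le> l * \<eta> - I"
    by (simp_all add: I_def)
  ultimately show ?thesis using that l(1) plus minus by blast
qed

end

section \<open>Continuity of the optimal proportions\<close>

lemma is_norm_equivalent:
  fixes N :: "'a::euclidean_space \<Rightarrow> real"
  assumes "is_norm N"
  obtains c C where "0 < c" "0 < C" "\<And>x. c * norm x \<le> N x" "\<And>x. N x \<le> C * norm x"
proof -
  have nonneg: "0 \<le> N x" and zero: "N x = 0 \<longleftrightarrow> x = 0" and scale: "N (a *\<^sub>R x) = \<bar>a\<bar> * N x"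
    and triangle: "N (x + y) \<le> N x + N y" for x y a
    using assms by (auto simp: is_norm_def)
  define C where "C = 1 + (\<Sum>b\<in>Basis. N b)"
  have C: "0 < C" by (simp add: C_def add_pos_nonneg sum_nonneg nonneg)
  have sum_le: "N (\<Sum>b\<in>B. f b) \<le> (\<Sum>b\<in>B. N (f b))" if "finite B" for B :: "'a set" and f
    using that
  proof induction
    case (insert b B)
    then show ?case using triangle[of "f b" "sum f B"] by simp
  qed (simp add: zero[THEN iffD2])
  have upper: "N x \<le> C * norm x" for x
  proof -
    have "N x = N (\<Sum>b\<in>Basis. (x \<bullet> b) *\<^sub>R b)" by (simp add: euclidean_representation)
    also have "\<dots> \<le> (\<Sum>b\<in>Basis. \<bar>x \<bullet> b\<bar> * N b)"
      using sum_le[of Basis "\<lambda>b. (x \<bullet> b) *\<^sub>R b"] by (simp add: scale)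
    also have "\<dots> \<le> (\<Sum>b\<in>Basis. norm x * N b)"
      by (intro sum_mono mult_right_mono nonneg) (auto simp: Basis_le_norm)
    also have "\<dots> \<le> C * norm x"
      by (simp add: C_def sum_distrib_left sum_distrib_right algebra_simps)
    finally show ?thesis .
  qed
  have lipschitz: "\<bar>N x - N y\<bar> \<le> C * norm (x - y)" for x y
  proof -
    have "N x \<le> N (x - y) + N y" "N y \<le> N (y - x) + N x"
      using triangle[of "x - y" y] triangle[of "y - x" x] by simp_all
    then show ?thesis using upper[of "x - y"] upper[of "y - x"] by (simp add: norm_minus_commute)
  qed
  have "continuous_on (sphere 0 1) N"
    by (rule lipschitz_on_continuous_on[of C])
       (use C in \<open>auto simp: lipschitz_on_def dist_norm lipschitz\<close>)
  moreover have "sphere (0::'a) 1 \<noteq> {}" by simp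
  ultimately obtain x0 where x0: "x0 \<in> sphere 0 1" "\<And>x. x \<in> sphere 0 1 \<Longrightarrow> N x0 \<le> N x"
    using continuous_attains_inf[OF compact_sphere] by metis
  have "0 < N x0" using x0(1) nonneg[of x0] zero[of x0] by (auto simp: less_le)
  moreover have "N x0 * norm x \<le> N x" for x
  proof (cases "x = 0")
    case False
    then have "N x0 \<le> N ((1 / norm x) *\<^sub>R x)" by (intro x0(2)) simp
    then show ?thesis using False by (simp add: scale field_simps)
  qed (simp add: zero[THEN iffD2])
  ultimately show ?thesis using C upper that by blast
qed

lemma distributions_compact: "compact (distributions :: (real ^ 'u::finite) set)"
proof -
  have "distributions = (\<Inter>u. {q :: real ^ 'u. 0 \<le> q $ u}) \<inter> {q. (\<Sum>u\<in>UNIV. q $ u) = 1}"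
    by (auto simp: distributions_def)
  moreover have "closed \<dots>"
    by (intro closed_Int closed_INT ballI closed_Collect_le closed_Collect_eq continuous_intros)
  moreover have "norm q \<le> 1" if "q \<in> distributions" for q :: "real ^ 'u"
    using that norm_le_l1_cart[of q] by (simp add: distributions_def)
  ultimately show ?thesis by (auto simp: compact_eq_bounded_closed bounded_iff)
qed

lemma distributions_nonneg: "q \<in> distributions \<Longrightarrow> 0 \<le> q $ u"
  and distributions_sum: "q \<in> distributions \<Longrightarrow> (\<Sum>u\<in>UNIV. q $ u) = 1"
  by (auto simp: distributions_def)

lemma distributions_le_1: "q \<in> distributions \<Longrightarrow> q $ u \<le> 1"
  using member_le_sum[of u UNIV "\<lambda>u. q $ u"] by (simp add: distributions_def)

section \<open>Norm distances and separation of the hypotheses\<close>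

context hypothesis_sets
begin

lemma nrm_triangle: "nrm (x - z) \<le> nrm (x - y) + nrm (y - z)"
proof -
  have "nrm ((x - y) + (y - z)) \<le> nrm (x - y) + nrm (y - z)"
    using nrm unfolding is_norm_def by blast
  then show ?thesis by simp
qed

lemma nrm_commute: "nrm (x - y) = nrm (y - x)"
proof -
  have "nrm ((- 1) *\<^sub>R (y - x)) = \<bar>- 1\<bar> * nrm (y - x)" using nrm unfolding is_norm_def by blast
  then show ?thesis by simp
qed

lemma dist_to_le: "t \<in> A \<Longrightarrow> dist_to nrm x A \<le> nrm (x - t)"
  unfolding dist_to_def
  by (rule cINF_lower) (use nrm in \<open>auto simp: is_norm_def intro!: bdd_belowI[of _ 0]\<close>)

lemma \<Theta>_nonempty: "\<Theta> m \<noteq> {}"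
  using pieces_nonempty[of 1 m] npieces_pos[of m] by (auto simp: \<Theta>_def)

lemma \<Theta>_subset: "\<Theta> m \<subseteq> param_space"
  unfolding \<Theta>_def using pieces_in_param_space by blast

lemma \<Theta>_unique: "\<theta> \<in> \<Theta> m \<Longrightarrow> \<theta> \<in> \<Theta> m' \<Longrightarrow> m' = m"
  using hyps_disjoint by (fastforce simp: \<Theta>_def)

lemma g_eq: "\<theta> \<in> \<Theta> m \<Longrightarrow> g \<theta> = m"
  unfolding g_def using \<Theta>_unique by blast

lemma \<Theta>_separated:
  assumes "\<theta> \<in> \<Theta> m"
  obtains r where "0 < r" "\<And>m' t. m' \<noteq> m \<Longrightarrow> t \<in> \<Theta> m' \<Longrightarrow> r \<le> nrm (\<theta> - t)"
proof -
  obtain i where i: "i \<in> {1..npieces m}" "\<theta> \<in> \<Gamma> m i" using assms by (auto simp: \<Theta>_def)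
  \<comment> \<open>Each of the finitely many pieces admits all small \<open>r\<close>; the filter
    combines these conditions without naming a minimum.\<close>
  have "\<forall>\<^sub>F r in at_right 0. m' \<noteq> m \<longrightarrow> (\<forall>t\<in>\<Gamma> m' j. r \<le> nrm (\<theta> - t))"
    if j: "j \<in> {1..npieces m'}" for m' j
  proof (cases "m' = m")
    case False
    then have "0 < dist_to nrm \<theta> (\<Gamma> m' j)" using pieces_separated i j by blast
    then have "\<forall>\<^sub>F r in at_right 0. r < dist_to nrm \<theta> (\<Gamma> m' j)"
      by (auto simp: eventually_at_right_field)
    then show ?thesis by eventually_elim (meson dist_to_le less_imp_le order_trans)
  qed simp
  then have "\<forall>\<^sub>F r in at_right 0. \<forall>j\<in>{1..npieces m'}. m' \<noteq> m \<longrightarrow> (\<forall>t\<in>\<Gamma> m' j. r \<le> nrm (\<theta> - t))" for m'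
    by (intro eventually_ball_finite) auto
  then have "\<forall>\<^sub>F r in at_right 0. \<forall>m'. \<forall>j\<in>{1..npieces m'}. m' \<noteq> m \<longrightarrow> (\<forall>t\<in>\<Gamma> m' j. r \<le> nrm (\<theta> - t))"
    by (intro eventually_all_finite)
  then have "\<forall>\<^sub>F r in at_right (0::real). 0 < r \<and> (\<forall>m'. m' \<noteq> m \<longrightarrow> (\<forall>t\<in>\<Theta> m'. r \<le> nrm (\<theta> - t)))"
    using eventually_at_right_less[of 0] by eventually_elim (auto simp: \<Theta>_def)
  from eventually_happens'[OF trivial_limit_at_right_real this]
  obtain r :: real where "0 < r" "\<forall>m'. m' \<noteq> m \<longrightarrow> (\<forall>t\<in>\<Theta> m'. r \<le> nrm (\<theta> - t))" by blast
  then show ?thesis by (intro that[of r]) auto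
qed

lemma nearest_hypothesis:
  assumes \<theta>: "\<theta> \<in> \<Theta> m"
    and sep: "\<And>m' t. m' \<noteq> m \<Longrightarrow> t \<in> \<Theta> m' \<Longrightarrow> r \<le> nrm (\<theta> - t)"
    and near: "nrm (x - \<theta>) < r / 2"
    and min: "is_arg_min (\<lambda>m. dist_to nrm x (\<Theta> m)) (\<lambda>_. True) m'"
  shows "m' = m"
proof (rule ccontr)
  assume "m' \<noteq> m"
  have "dist_to nrm x (\<Theta> m') \<le> dist_to nrm x (\<Theta> m)"
    using min by (auto simp: is_arg_min_def not_less)
  also have "\<dots> \<le> nrm (x - \<theta>)" by (rule dist_to_le[OF \<theta>])
  finally have "dist_to nrm x (\<Theta> m') < r / 2" using near by simp
  then obtain t where t: "t \<in> \<Theta> m'" "nrm (x - t) < r / 2"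
    unfolding dist_to_def
    by (subst (asm) cINF_less_iff)
       (use nrm \<Theta>_nonempty in \<open>auto simp: is_norm_def intro!: bdd_belowI[of _ 0]\<close>)
  then show False
    using sep[OF \<open>m' \<noteq> m\<close> t(1)] nrm_triangle[of \<theta> t x] near nrm_commute[of x \<theta>] by linarith
qed

section \<open>Costs of alternatives and stability of the maximizer\<close>

definition cost :: "real ^ 'u \<Rightarrow> real ^ 'u \<Rightarrow> real ^ 'u \<Rightarrow> real" where
  "cost \<theta> q t = (\<Sum>u\<in>UNIV. q $ u * KL u \<theta> t)"

lemma KL_nonneg: "\<theta> \<in> param_space \<Longrightarrow> t \<in> param_space \<Longrightarrow> 0 \<le> KL u \<theta> t"
  by (simp add: KL_eq_bregman bregman_nonneg param_space_def)

lemma cost_nonneg: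
  "\<theta> \<in> param_space \<Longrightarrow> t \<in> param_space \<Longrightarrow> q \<in> distributions \<Longrightarrow> 0 \<le> cost \<theta> q t"
  unfolding cost_def by (intro sum_nonneg mult_nonneg_nonneg KL_nonneg distributions_nonneg)

lemma alternatives:
  assumes "\<theta> \<in> \<Theta> m"
  shows "(\<Union>m. \<Theta> m) - \<Theta> (g \<theta>) = (\<Union>m'\<in>-{m}. \<Theta> m')"
  unfolding g_eq[OF assms] by (auto dest: \<Theta>_unique)

text \<open>Replaces the extended-real infimum by inequalities between reals. It also covers the
  case without any alternative, where \<open>info\<close> is infinite.\<close>

lemma le_info_iff:
  assumes "\<theta> \<in> \<Theta> m"
  shows "ereal x \<le> info \<theta> q \<longleftrightarrow> (\<forall>m' t. m' \<noteq> m \<longrightarrow> t \<in> \<Theta> m' \<longrightarrow> x \<le> cost \<theta> q t)"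
  unfolding info_def alternatives[OF assms] by (auto simp: le_INF_iff cost_def)

lemma info_nonneg:
  assumes "\<theta> \<in> \<Theta> m" "q \<in> distributions"
  shows "0 \<le> info \<theta> q"
  using le_info_iff[OF assms(1), of 0 q] cost_nonneg assms \<Theta>_subset
  by (simp add: zero_ereal_def) (meson subsetD)

lemma KL_perturb:
  assumes \<theta>: "\<theta> \<in> param_space" and "0 < \<epsilon>"
  shows "\<forall>\<^sub>F \<theta>' in nhds \<theta>. \<forall>u. \<forall>t\<in>param_space. \<bar>KL u \<theta>' t - KL u \<theta> t\<bar> \<le> \<epsilon> * (1 + KL u \<theta> t)"
proof (rule eventually_all_finite)
  fix u
  have lim: "filterlim (\<lambda>\<theta>'. \<theta>' $ u) (nhds (\<theta> $ u)) (nhds \<theta>)"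
    by (intro tendsto_vec_nth filterlim_ident)
  have "\<theta> $ u \<in> nat_params u" using \<theta> by (simp add: param_space_def)
  from eventually_compose_filterlim[OF bregman_perturb[OF this assms(2)] lim]
  show "\<forall>\<^sub>F \<theta>' in nhds \<theta>. \<forall>t\<in>param_space. \<bar>KL u \<theta>' t - KL u \<theta> t\<bar> \<le> \<epsilon> * (1 + KL u \<theta> t)"
    by eventually_elim (simp add: KL_eq_bregman param_space_def)
qed

text \<open>The weights sum to one, so the coordinatewise errors average to the same relative error
  for every \<open>q\<close>. Uniformity in \<open>q\<close> matters because it is later applied to
  the unknown maximizer at the perturbed parameter.\<close>

lemma cost_perturb:
  assumes \<theta>: "\<theta> \<in> param_space" and "0 < \<epsilon>"
  shows "\<forall>\<^sub>F \<theta>' in nhds \<theta>. \<forall>q\<in>distributions. \<forall>t\<in>param_space.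
           \<bar>cost \<theta>' q t - cost \<theta> q t\<bar> \<le> \<epsilon> * (1 + cost \<theta> q t)"
  using KL_perturb[OF assms]
proof eventually_elim
  case (elim \<theta>')
  show ?case
  proof (intro ballI)
    fix q :: "real ^ 'u" and t assume q: "q \<in> distributions" and t: "t \<in> param_space"
    have "cost \<theta>' q t - cost \<theta> q t = (\<Sum>u\<in>UNIV. q $ u * (KL u \<theta>' t - KL u \<theta> t))"
      by (simp add: cost_def sum_subtractf right_diff_distrib)
    then have "\<bar>cost \<theta>' q t - cost \<theta> q t\<bar> \<le> (\<Sum>u\<in>UNIV. \<bar>q $ u * (KL u \<theta>' t - KL u \<theta> t)\<bar>)"
      by (simp add: sum_abs)
    also have "\<dots> \<le> (\<Sum>u\<in>UNIV. q $ u * (\<epsilon> * (1 + KL u \<theta> t)))"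
      using elim t distributions_nonneg[OF q] by (intro sum_mono) (simp add: abs_mult mult_left_mono)
    also have "\<dots> = \<epsilon> * ((\<Sum>u\<in>UNIV. q $ u) + cost \<theta> q t)"
      by (simp add: cost_def sum_distrib_left distrib_left sum.distrib mult_ac)
    finally show "\<bar>cost \<theta>' q t - cost \<theta> q t\<bar> \<le> \<epsilon> * (1 + cost \<theta> q t)"
      by (simp add: distributions_sum[OF q])
  qed
qed

text \<open>As an infimum of functions linear in \<open>q\<close>, \<open>info \<theta>\<close> is
  upper semicontinuous. On the compact set of distributions at distance at least \<open>r\<close>
  from the unique maximizer it therefore stays below one level under \<open>D_star \<theta>\<close>;
  a finite subcover by open sublevel sets provides that level.\<close>

lemma near_optimal_near_maximizer:
  assumes \<theta>: "\<theta> \<in> \<Theta> m" and "0 < r"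
    and q0: "q0 \<in> distributions"
    and unique: "\<And>q. q \<in> distributions \<Longrightarrow> info \<theta> q = D_star \<theta> \<Longrightarrow> q = q0"
  obtains x where "ereal x < D_star \<theta>"
    "\<And>q u. q \<in> distributions \<Longrightarrow> ereal x \<le> info \<theta> q \<Longrightarrow> \<bar>q $ u - q0 $ u\<bar> < r"
proof -
  define K where "K = distributions \<inter> (\<Union>u. {q. r \<le> \<bar>q $ u - q0 $ u\<bar>})"
  have "compact K"
    unfolding K_def
    by (intro compact_Int_closed distributions_compact closed_UN ballI closed_Collect_le
        continuous_intros finite_class.finite_UNIV)
  define O' where "O' x = (\<Union>m'\<in>-{m}. \<Union>t\<in>\<Theta> m'. {q. cost \<theta> q t < x})" for x
  have "open (O' x)" for x
    unfolding O'_def cost_def by (intro open_UN ballI open_Collect_less continuous_intros)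
  have le_D: "info \<theta> q \<le> D_star \<theta>" if "q \<in> distributions" for q
    unfolding D_star_def by (rule SUP_upper[OF that])
  have "K \<subseteq> (\<Union>x\<in>{x. ereal x < D_star \<theta>}. O' x)"
  proof
    fix q assume "q \<in> K"
    then have q: "q \<in> distributions" and "q \<noteq> q0" using \<open>0 < r\<close> by (auto simp: K_def)
    then have "info \<theta> q < D_star \<theta>" using le_D[OF q] unique[OF q] by (auto simp: less_le)
    then obtain x where x: "info \<theta> q < ereal x" "ereal x < D_star \<theta>" using ereal_dense2 by blast
    then have "\<not> ereal x \<le> info \<theta> q" by simp
    then have "q \<in> O' x" unfolding le_info_iff[OF \<theta>] O'_def by fastforce
    then show "q \<in> (\<Union>x\<in>{x. ereal x < D_star \<theta>}. O' x)" using x by blast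
  qed
  with \<open>compact K\<close> \<open>\<And>x. open (O' x)\<close> obtain X where X: "X \<subseteq> {x. ereal x < D_star \<theta>}" "finite X"
      "K \<subseteq> (\<Union>x\<in>X. O' x)"
    by (metis compactE_image)
  have "-\<infinity> < D_star \<theta>" using info_nonneg[OF \<theta> q0] le_D[OF q0] by (metis MInfty_neq_ereal(1) ereal_infty_less(2) not_less zero_ereal_def order_trans ereal_infty_less_eq(2))
  \<comment> \<open>\<open>x0\<close> provides a level also when no distribution is far from
    \<open>q0\<close> and the finite cover may be empty.\<close>
  then obtain x0 where x0: "ereal x0 < D_star \<theta>" using ereal_dense2 by blast
  define x where "x = Max (insert x0 X)"
  have "x \<in> insert x0 X" unfolding x_def using X(2) by (intro Max_in) auto
  then have "ereal x < D_star \<theta>" using X(1) x0 by auto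
  moreover have "\<bar>q $ u - q0 $ u\<bar> < r" if q: "q \<in> distributions" "ereal x \<le> info \<theta> q" for q u
  proof (rule ccontr)
    assume "\<not> \<bar>q $ u - q0 $ u\<bar> < r"
    then have "q \<in> K" using q by (auto simp: K_def not_less)
    then obtain y m' t where y: "y \<in> X" "m' \<noteq> m" "t \<in> \<Theta> m'" "cost \<theta> q t < y"
      using X(3) unfolding O'_def by blast
    then have "y \<le> x" using X(2) by (simp add: x_def)
    moreover have "x \<le> cost \<theta> q t" using q(2) y by (simp add: le_info_iff[OF \<theta>])
    ultimately show False using y(4) by simp
  qed
  ultimately show ?thesis using that by blast
qed

lemma q_star_props:
  assumes "\<exists>!q. q \<in> distributions \<and> info \<theta> q = D_star \<theta>"
  shows "q_star \<theta> \<in> distributions" "info \<theta> (q_star \<theta>) = D_star \<theta>"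
    "\<And>q. q \<in> distributions \<Longrightarrow> info \<theta> q = D_star \<theta> \<Longrightarrow> q = q_star \<theta>"
  using theI'[OF assms] assms unfolding q_star_def by blast+

text \<open>The old maximizer remains nearly optimal at \<open>\<theta>'\<close>, the new one does
  at least as well there, and transferring back to \<open>\<theta>\<close> makes the new one nearly
  optimal at \<open>\<theta>\<close>. Membership of \<open>\<theta>'\<close> in the same hypothesis
  keeps the set of alternatives unchanged.\<close>

lemma q_star_near:
  assumes \<theta>: "\<theta> \<in> \<Theta> m" and "0 < r"
    and unique: "\<And>\<theta>'. \<theta>' \<in> (\<Union>m. \<Theta> m) \<Longrightarrow> \<exists>!q. q \<in> distributions \<and> info \<theta>' q = D_star \<theta>'"
  shows "\<forall>\<^sub>F \<theta>' in nhds \<theta>. \<theta>' \<in> \<Theta> m \<longrightarrow> (\<forall>u. \<bar>q_star \<theta>' $ u - q_star \<theta> $ u\<bar> < r)"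
proof -
  have "\<theta> \<in> (\<Union>m. \<Theta> m)" using \<theta> by blast
  note q0 = q_star_props[OF unique[OF this]]
  obtain x where x: "ereal x < D_star \<theta>"
    "\<And>q u. q \<in> distributions \<Longrightarrow> ereal x \<le> info \<theta> q \<Longrightarrow> \<bar>q $ u - q_star \<theta> $ u\<bar> < r"
    using near_optimal_near_maximizer[OF \<theta> \<open>0 < r\<close> q0(1,3)] by metis
  obtain y where y: "x < y" "ereal y < D_star \<theta>" using ereal_dense2[OF x(1)] by auto
  \<comment> \<open>What survives of level \<open>y\<close> after both transfers: passing to
    \<open>\<theta>'\<close> leaves \<open>(1 - s) * y - s\<close>, and passing back subtracts
    another \<open>s\<close> and divides by \<open>1 + s\<close>.\<close>
  have "((\<lambda>s. ((1 - s) * y - 2 * s) / (1 + s)) \<longlongrightarrow> ((1 - 0) * y - 2 * 0) / (1 + 0)) (at_right 0)"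
    by (intro tendsto_intros) auto
  then have "\<forall>\<^sub>F s in at_right 0. x < ((1 - s) * y - 2 * s) / (1 + s)"
    using y(1) by (intro order_tendstoD(1)) simp_all
  moreover have "\<forall>\<^sub>F s in at_right (0::real). 0 < s \<and> s < 1"
    using eventually_at_right_less[of 0] eventually_at_right_real[of 0 1] by (auto elim: eventually_elim2)
  ultimately have "\<forall>\<^sub>F s in at_right (0::real). x < ((1 - s) * y - 2 * s) / (1 + s) \<and> 0 < s \<and> s < 1"
    by (rule eventually_conj)
  from eventually_happens'[OF trivial_limit_at_right_real this]
  obtain s where s: "x < ((1 - s) * y - 2 * s) / (1 + s)" "0 < s" "s < 1" by blast
  have params: "\<theta> \<in> param_space" using \<theta> \<Theta>_subset by blast
  from cost_perturb[OF params s(2)] show ?thesis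
  proof eventually_elim
    case (elim \<theta>')
    have close: "\<bar>cost \<theta>' q t - cost \<theta> q t\<bar> \<le> s * (1 + cost \<theta> q t)"
      if "q \<in> distributions" "t \<in> \<Theta> m'" for q t m'
      using elim that \<Theta>_subset by blast
    show ?case
    proof (intro impI allI)
      fix u assume \<theta>': "\<theta>' \<in> \<Theta> m"
      then have "\<theta>' \<in> (\<Union>m. \<Theta> m)" by blast
      note q' = q_star_props[OF unique[OF this]]
      have "ereal y \<le> info \<theta> (q_star \<theta>)" using y(2) q0(2) by simp
      then have "(1 - s) * y - s \<le> cost \<theta>' (q_star \<theta>) t" if "m' \<noteq> m" "t \<in> \<Theta> m'" for m' t
      proof -
        have "y \<le> cost \<theta> (q_star \<theta>) t"
          using \<open>ereal y \<le> info \<theta> (q_star \<theta>)\<close> that by (simp add: le_info_iff[OF \<theta>])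
        then have "(1 - s) * y \<le> (1 - s) * cost \<theta> (q_star \<theta>) t" using s by (intro mult_left_mono) auto
        then show ?thesis using close[OF q0(1) that(2)] by (simp add: algebra_simps abs_le_iff)
      qed
      then have "ereal ((1 - s) * y - s) \<le> info \<theta>' (q_star \<theta>)" by (simp add: le_info_iff[OF \<theta>'])
      also have "\<dots> \<le> info \<theta>' (q_star \<theta>')"
        unfolding q'(2) unfolding D_star_def by (rule SUP_upper[OF q0(1)])
      finally have lower: "(1 - s) * y - s \<le> cost \<theta>' (q_star \<theta>') t" if "m' \<noteq> m" "t \<in> \<Theta> m'" for m' t
        using that by (simp add: le_info_iff[OF \<theta>'])
      have "x \<le> cost \<theta> (q_star \<theta>') t" if t: "m' \<noteq> m" "t \<in> \<Theta> m'" for m' t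
      proof -
        have "x * (1 + s) < (1 - s) * y - 2 * s" using s by (simp add: pos_less_divide_eq)
        also have "\<dots> \<le> cost \<theta> (q_star \<theta>') t * (1 + s)"
          using lower[OF t] close[OF q'(1) t(2)] by (simp add: algebra_simps abs_le_iff)
        finally show ?thesis using s by simp
      qed
      then have "ereal x \<le> info \<theta> (q_star \<theta>')" by (simp add: le_info_iff[OF \<theta>])
      then show "\<bar>q_star \<theta>' $ u - q_star \<theta> $ u\<bar> < r" by (rule x(2)[OF q'(1)])
    qed
  qed
qed

end

section \<open>Concentration of the empirical means\<close>

context controlled_sampling
begin

interpretation P: prob_space P by (rule prob_space_P)

section \<open>Counts, sums and the likelihood ratio\<close>

definition S :: "'u \<Rightarrow> nat \<Rightarrow> 'w \<Rightarrow> real" where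
  "S u n w = (\<Sum>k\<in>{k \<in> {1..n}. U k w = u}. T u (Y k w))"

lemma pulls_Suc:
  "{k \<in> {1..Suc n}. U k w = u} =
    (if U (Suc n) w = u then insert (Suc n) {k \<in> {1..n}. U k w = u} else {k \<in> {1..n}. U k w = u})"
  by (auto simp: le_Suc_eq)

lemma N_0 [simp]: "N u 0 w = 0" and S_0 [simp]: "S u 0 w = 0"
  by (simp_all add: N_def S_def)

lemma N_Suc: "N u (Suc n) w = N u n w + (if U (Suc n) w = u then 1 else 0)"
  unfolding N_def pulls_Suc by simp

lemma S_Suc: "S u (Suc n) w = S u n w + (if U (Suc n) w = u then T u (Y (Suc n) w) else 0)"
  unfolding S_def pulls_Suc by (simp add: add.commute)

lemma sum_N: "(\<Sum>u\<in>UNIV. real (N u n w)) = real n"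
  by (induction n) (simp_all add: N_Suc sum.distrib of_nat_sum[symmetric] del: of_nat_sum)

text \<open>Written as a product and not as a quotient, so it also holds on paths where the
  likelihood vanishes.\<close>

lemma lik_ratio:
  "lik n w t = lik n w t0 * exp (\<Sum>u\<in>UNIV. (t $ u - t0 $ u) * S u n w
     - real (N u n w) * (log_partition u (t $ u) - log_partition u (t0 $ u)))"
proof -
  have "obs_density t u y = obs_density t0 u y * exp ((t $ u - t0 $ u) * T u y
      - (log_partition u (t $ u) - log_partition u (t0 $ u)))" for u y
    by (simp add: obs_density_def exp_diff exp_add[symmetric] field_simps flip: exp_add exp_diff)
  then have "lik n w t = (\<Prod>u\<in>UNIV. \<Prod>k\<in>{k \<in> {1..n}. U k w = u}. obs_density t0 u (Y k w) *
      exp ((t $ u - t0 $ u) * T u (Y k w) - (log_partition u (t $ u) - log_partition u (t0 $ u))))"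
    unfolding lik_def by simp
  also have "\<dots> = lik n w t0 * (\<Prod>u\<in>UNIV. exp (\<Sum>k\<in>{k \<in> {1..n}. U k w = u}.
      (t $ u - t0 $ u) * T u (Y k w) - (log_partition u (t $ u) - log_partition u (t0 $ u))))"
    by (simp add: lik_def prod.distrib exp_sum)
  finally have "lik n w t = lik n w t0 * (\<Prod>u\<in>UNIV. exp (\<Sum>k\<in>{k \<in> {1..n}. U k w = u}.
      (t $ u - t0 $ u) * T u (Y k w) - (log_partition u (t $ u) - log_partition u (t0 $ u))))" .
  moreover have "(\<Sum>k\<in>{k \<in> {1..n}. U k w = u}.
      (t $ u - t0 $ u) * T u (Y k w) - (log_partition u (t $ u) - log_partition u (t0 $ u))) =
      (t $ u - t0 $ u) * S u n w - real (N u n w) * (log_partition u (t $ u) - log_partition u (t0 $ u))" for u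
    by (simp add: S_def N_def sum_subtractf sum_distrib_left)
  ultimately show ?thesis by (simp only: exp_sum finite_class.finite_UNIV)
qed

section \<open>Measurability with respect to the history\<close>

lemma space_history [simp]: "space (history P \<mu> U Y n) = space P"
  by (simp add: history_def space_measure_of_conv)

lemma sets_history_subset: "sets (history P \<mu> U Y n) \<subseteq> sets P"
proof -
  have "(\<lambda>w. (U k w, Y k w)) -` B \<inter> space P \<in> sets P"
    if "k \<in> {1..n}" "B \<in> sets (count_space UNIV \<Otimes>\<^sub>M \<mu>)" for k B
    by (rule measurable_sets[OF _ that(2)])
       (use that U_measurable Y_measurable in \<open>auto intro!: measurable_Pair\<close>)
  then show ?thesis
    unfolding history_def
    by (subst sets_measure_of) (auto intro!: sets.sigma_sets_subset)
qed

lemma measurable_from_history: "f \<in> measurable (history P \<mu> U Y n) M \<Longrightarrow> f \<in> measurable P M"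
  using sets_history_subset[of n] by (auto simp: measurable_def)

lemma pair_measurable_history:
  assumes "k \<in> {1..n}"
  shows "(\<lambda>w. (U k w, Y k w)) \<in> measurable (history P \<mu> U Y n) (count_space UNIV \<Otimes>\<^sub>M \<mu>)"
proof (rule measurableI)
  fix w assume "w \<in> space (history P \<mu> U Y n)"
  then have "Y k w \<in> space \<mu>" using assms by (intro measurable_space[OF Y_measurable]) auto
  then show "(U k w, Y k w) \<in> space (count_space UNIV \<Otimes>\<^sub>M \<mu>)" by (simp add: space_pair_measure)
next
  fix B :: "('u \<times> 'y) set" assume "B \<in> sets (count_space UNIV \<Otimes>\<^sub>M \<mu>)"
  then show "(\<lambda>w. (U k w, Y k w)) -` B \<inter> space (history P \<mu> U Y n) \<in> sets (history P \<mu> U Y n)"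
    unfolding space_history unfolding history_def using assms
    by (intro in_measure_of) auto
qed

lemma U_history: "k \<in> {1..n} \<Longrightarrow> U k \<in> measurable (history P \<mu> U Y n) (count_space UNIV)"
  using measurable_compose[OF pair_measurable_history measurable_fst] by simp

lemma Y_history: "k \<in> {1..n} \<Longrightarrow> Y k \<in> measurable (history P \<mu> U Y n) \<mu>"
  using measurable_compose[OF pair_measurable_history measurable_snd] by simp

lemma pull_indicator_history:
  "k \<in> {1..n} \<Longrightarrow> {w \<in> space (history P \<mu> U Y n). U k w = u} \<in> sets (history P \<mu> U Y n)"
  using measurable_sets[OF U_history, of k n "{u}"] by (simp add: vimage_def Int_def conj_commute)

lemma N_history: "(\<lambda>w. real (N u n w)) \<in> borel_measurable (history P \<mu> U Y n)"
proof -
  have "real (N u n w) = (\<Sum>k\<in>{1..n}. if U k w = u then 1 else 0)" for w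
    by (simp add: N_def sum.If_cases Int_def)
  then show ?thesis
    by (auto intro!: borel_measurable_sum measurable_If pull_indicator_history)
qed

lemma S_history: "S u n \<in> borel_measurable (history P \<mu> U Y n)"
proof -
  have "S u n = (\<lambda>w. \<Sum>k\<in>{1..n}. if U k w = u then T u (Y k w) else 0)"
    by (auto simp: S_def sum.If_cases Int_def fun_eq_iff)
  then show ?thesis
    by (auto intro!: borel_measurable_sum measurable_If pull_indicator_history
        measurable_compose[OF Y_history T_measurable])
qed

lemma N_borel [measurable]: "(\<lambda>w. real (N u n w)) \<in> borel_measurable P"
  and S_borel [measurable]: "S u n \<in> borel_measurable P"
  by (rule measurable_from_history, rule N_history) (rule measurable_from_history, rule S_history)

lemma obs_density_measurable: "(\<lambda>y. ennreal (obs_density t u y)) \<in> borel_measurable \<mu>"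
  using h_measurable T_measurable unfolding obs_density_def by measurable

text \<open>Extends the conditional law from events to integrands, first in the observation and then
  in the past.\<close>

lemma nn_integral_next_observation:
  assumes n: "1 \<le> n" and f: "f \<in> borel_measurable (history P \<mu> U Y (n - 1))"
    and \<psi>: "\<psi> \<in> borel_measurable \<mu>"
  shows "(\<integral>\<^sup>+w. f w * (indicator {w. U n w = u} w * \<psi> (Y n w)) \<partial>P) =
    (\<integral>\<^sup>+w. f w * indicator {w. U n w = u} w \<partial>P) * (\<integral>\<^sup>+y. ennreal (obs_density \<theta> u y) * \<psi> y \<partial>\<mu>)"
proof -
  let ?H = "history P \<mu> U Y (n - 1)" and ?A = "{w \<in> space P. U n w = u}"
  let ?\<nu> = "density \<mu> (\<lambda>y. ennreal (obs_density \<theta> u y))"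
  let ?c = "\<integral>\<^sup>+y. ennreal (obs_density \<theta> u y) * \<psi> y \<partial>\<mu>"
  note [measurable] = Y_measurable[OF n] U_measurable[OF n] \<psi>
  have A [measurable]: "?A \<in> sets P" by measurable
  have fixed: "(\<integral>\<^sup>+w. indicator (G \<inter> ?A) w * \<psi> (Y n w) \<partial>P) = emeasure P (G \<inter> ?A) * ?c"
    if G: "G \<in> sets ?H" for G
  proof -
    have GP [measurable]: "G \<in> sets P" using G sets_history_subset by blast
    \<comment> \<open>On a fixed history event the assumed product formula says that two measures on
      the observation space coincide; integrating \<open>\<psi>\<close> against both gives
      \<open>fixed\<close>.\<close>
    have "distr (density P (indicator (G \<inter> ?A))) \<mu> (Y n) = scale_measure (emeasure P (G \<inter> ?A)) ?\<nu>"
    proof (rule measure_eqI)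
      fix B assume "B \<in> sets (distr (density P (indicator (G \<inter> ?A))) \<mu> (Y n))"
      then have B [measurable]: "B \<in> sets \<mu>" by simp
      have "emeasure (distr (density P (indicator (G \<inter> ?A))) \<mu> (Y n)) B =
          emeasure (density P (indicator (G \<inter> ?A))) (Y n -` B \<inter> space P)"
        by (subst emeasure_distr) (auto simp: measurable_density_eq1)
      also have "\<dots> = emeasure P (G \<inter> {w \<in> space P. U n w = u \<and> Y n w \<in> B})"
        by (subst emeasure_density)
           (auto simp: indicator_inter_arith[symmetric] intro!: arg_cong[where f="emeasure P"])
      also have "\<dots> = emeasure P (G \<inter> ?A) * emeasure ?\<nu> B"
        by (rule Y_conditional_law[OF n G B])
      finally show "emeasure (distr (density P (indicator (G \<inter> ?A))) \<mu> (Y n)) B =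
          emeasure (scale_measure (emeasure P (G \<inter> ?A)) ?\<nu>) B" by simp
    qed simp
    then have "(\<integral>\<^sup>+y. \<psi> y \<partial>distr (density P (indicator (G \<inter> ?A))) \<mu> (Y n)) =
        (\<integral>\<^sup>+y. \<psi> y \<partial>scale_measure (emeasure P (G \<inter> ?A)) ?\<nu>)" by simp
    also have "\<dots> = emeasure P (G \<inter> ?A) * ?c"
      by (subst nn_integral_scale_measure)
         (auto simp: nn_integral_density obs_density_measurable)
    also have "(\<integral>\<^sup>+y. \<psi> y \<partial>distr (density P (indicator (G \<inter> ?A))) \<mu> (Y n)) =
        (\<integral>\<^sup>+w. indicator (G \<inter> ?A) w * \<psi> (Y n w) \<partial>P)"
      by (subst nn_integral_distr) (auto simp: nn_integral_density measurable_density_eq1)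
    finally show ?thesis .
  qed
  let ?M1 = "distr (density P (\<lambda>w. indicator ?A w * \<psi> (Y n w))) ?H (\<lambda>w. w)"
  let ?M2 = "distr (density P (indicator ?A)) ?H (\<lambda>w. w)"
  \<comment> \<open>Both weighted laws are now restricted to the history. By \<open>fixed\<close>
    they are proportional there, so every history-measurable \<open>f\<close> integrates
    accordingly.\<close>
  have id: "(\<lambda>w. w) \<in> measurable P ?H"
    using measurable_from_history[OF measurable_ident_sets[OF refl]] .
  have "?M1 = scale_measure ?c ?M2"
  proof (rule measure_eqI)
    fix G assume "G \<in> sets ?M1"
    then have G: "G \<in> sets ?H" by simp
    then have GP [measurable]: "G \<in> sets P" using sets_history_subset by blast
    then have sub: "G \<subseteq> space P" by (rule sets.sets_into_space)
    have "emeasure ?M1 G = (\<integral>\<^sup>+w. indicator (G \<inter> ?A) w * \<psi> (Y n w) \<partial>P)"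
      using id G sub
      by (simp add: emeasure_distr emeasure_density measurable_density_eq1 Int_absorb2)
         (auto intro!: nn_integral_cong simp: indicator_def)
    also have "\<dots> = emeasure P (G \<inter> ?A) * ?c" by (rule fixed[OF G])
    also have "emeasure P (G \<inter> ?A) = emeasure ?M2 G"
      using id G sub
      by (simp add: emeasure_distr emeasure_density measurable_density_eq1 Int_absorb2
          indicator_inter_arith[symmetric] Int_commute)
    finally show "emeasure ?M1 G = emeasure (scale_measure ?c ?M2) G"
      by (simp add: mult.commute)
  qed simp
  then have "(\<integral>\<^sup>+w. f w \<partial>?M1) = (\<integral>\<^sup>+w. f w \<partial>scale_measure ?c ?M2)" by simp
  moreover have "(\<integral>\<^sup>+w. f w \<partial>scale_measure ?c ?M2) = ?c * (\<integral>\<^sup>+w. f w \<partial>?M2)"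
    using f by (intro nn_integral_scale_measure) simp
  moreover have "(\<integral>\<^sup>+w. f w \<partial>?M1) = (\<integral>\<^sup>+w. f w * (indicator {w. U n w = u} w * \<psi> (Y n w)) \<partial>P)"
    using f id measurable_from_history[OF f]
    by (simp add: nn_integral_distr nn_integral_density measurable_density_eq1)
       (auto intro!: nn_integral_cong simp: indicator_def mult.commute)
  moreover have "(\<integral>\<^sup>+w. f w \<partial>?M2) = (\<integral>\<^sup>+w. f w * indicator {w. U n w = u} w \<partial>P)"
    using f id measurable_from_history[OF f]
    by (simp add: nn_integral_distr nn_integral_density measurable_density_eq1)
       (auto intro!: nn_integral_cong simp: indicator_def)
  ultimately show ?thesis by (simp add: mult.commute)
qed

section \<open>The exponential martingale and its tail bound\<close>

lemma exp_tilt_integral: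
  assumes t: "t \<in> nat_params u"
  shows "(\<integral>\<^sup>+y. ennreal (obs_density \<theta> u y) *
    ennreal (exp ((t - \<theta> $ u) * T u y - (log_partition u t - log_partition u (\<theta> $ u)))) \<partial>\<mu>) = 1"
proof -
  have int: "integrable \<mu> (\<lambda>y. h u y * exp (t * T u y))" and pos: "0 < partition_fun u t"
    using t by (auto simp: nat_params_def)
  have "(\<integral>\<^sup>+y. ennreal (obs_density \<theta> u y) *
    ennreal (exp ((t - \<theta> $ u) * T u y - (log_partition u t - log_partition u (\<theta> $ u)))) \<partial>\<mu>) =
    (\<integral>\<^sup>+y. ennreal (h u y * exp (t * T u y) / partition_fun u t) \<partial>\<mu>)"
  proof (intro nn_integral_cong)
    fix y assume "y \<in> space \<mu>"
    then have h: "0 \<le> h u y" by (rule h_nonneg)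
    have "exp (\<theta> $ u * T u y - log_partition u (\<theta> $ u)) *
        exp ((t - \<theta> $ u) * T u y - (log_partition u t - log_partition u (\<theta> $ u))) =
        exp (t * T u y - log_partition u t)"
      by (simp add: algebra_simps flip: exp_add)
    also have "\<dots> = exp (t * T u y) / partition_fun u t"
      using pos by (simp add: exp_diff log_partition_def)
    finally show "ennreal (obs_density \<theta> u y) *
        ennreal (exp ((t - \<theta> $ u) * T u y - (log_partition u t - log_partition u (\<theta> $ u)))) =
      ennreal (h u y * exp (t * T u y) / partition_fun u t)"
      using h by (simp add: obs_density_def ennreal_mult[symmetric] mult.assoc)
  qed
  also have "\<dots> = ennreal (\<integral>y. h u y * exp (t * T u y) / partition_fun u t \<partial>\<mu>)"
    using int pos h_nonneg by (intro nn_integral_eq_integral) auto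
  also have "(\<integral>y. h u y * exp (t * T u y) / partition_fun u t \<partial>\<mu>) = 1"
    using pos by (simp add: partition_fun_def)
  finally show ?thesis by simp
qed

text \<open>The integrand is the likelihood ratio of \<open>t\<close> against
  \<open>\<theta> $ u\<close> over the observations of control \<open>u\<close> alone. It has mean
  one under any predictable choice of controls.\<close>

lemma exp_martingale:
  assumes t: "t \<in> nat_params u"
  shows "(\<integral>\<^sup>+w. ennreal (exp ((t - \<theta> $ u) * S u n w
    - real (N u n w) * (log_partition u t - log_partition u (\<theta> $ u)))) \<partial>P) = 1"
proof (induction n)
  case 0
  then show ?case by (simp add: P.emeasure_space_1)
next
  case (Suc n)
  define \<phi> where "\<phi> = log_partition u t - log_partition u (\<theta> $ u)"
  define E where "E n w = ennreal (exp ((t - \<theta> $ u) * S u n w - real (N u n w) * \<phi>))" for n w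
  define \<psi> where "\<psi> y = ennreal (exp ((t - \<theta> $ u) * T u y - \<phi>))" for y
  have E_history: "E n \<in> borel_measurable (history P \<mu> U Y (Suc n - 1))"
    unfolding E_def using S_history[of u n] N_history[of u n] by simp
  have \<psi>: "\<psi> \<in> borel_measurable \<mu>" unfolding \<psi>_def using T_measurable by measurable
  note [measurable] = measurable_from_history[OF E_history] U_measurable[of "Suc n"] Y_measurable[of "Suc n"] \<psi>
  have set [measurable]: "Measurable.pred P (\<lambda>w. U (Suc n) w = u)"
    by measurable
  \<comment> \<open>A step with another control leaves \<open>E\<close> unchanged; a step with
    \<open>u\<close> multiplies it by \<open>\<psi>\<close>, whose conditional mean is one.\<close>
  have "(\<integral>\<^sup>+w. E (Suc n) w \<partial>P) = (\<integral>\<^sup>+w. E n w * (indicator {w. U (Suc n) w = u} w * \<psi> (Y (Suc n) w))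
      + E n w * indicator {w. U (Suc n) w \<noteq> u} w \<partial>P)"
    by (intro nn_integral_cong)
       (auto simp: E_def \<psi>_def S_Suc N_Suc indicator_def algebra_simps simp flip: ennreal_mult exp_add)
  also have "\<dots> = (\<integral>\<^sup>+w. E n w * (indicator {w. U (Suc n) w = u} w * \<psi> (Y (Suc n) w)) \<partial>P)
      + (\<integral>\<^sup>+w. E n w * indicator {w. U (Suc n) w \<noteq> u} w \<partial>P)"
    by (intro nn_integral_add) measurable
  also have "\<dots> = (\<integral>\<^sup>+w. E n w * indicator {w. U (Suc n) w = u} w \<partial>P)
      + (\<integral>\<^sup>+w. E n w * indicator {w. U (Suc n) w \<noteq> u} w \<partial>P)"
    using nn_integral_next_observation[OF _ E_history \<psi>] exp_tilt_integral[OF t]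
    by (simp add: \<psi>_def \<phi>_def)
  also have "\<dots> = (\<integral>\<^sup>+w. E n w \<partial>P)"
    by (subst nn_integral_add[symmetric]) (auto intro!: nn_integral_cong simp: indicator_def)
  finally show ?case using Suc by (simp add: E_def \<phi>_def)
qed

text \<open>The count is random, but on the deviation event one of the two tilted likelihood ratios
  is at least \<open>exp (I * N)\<close>, so a deterministic lower bound \<open>m\<close> for the
  count suffices and no union over its values is taken.\<close>

lemma deviation_bound:
  assumes \<theta>: "\<theta> \<in> param_space" and "0 < \<eta>"
  obtains I where "0 < I"
    "\<And>n m. (\<And>w. w \<in> space P \<Longrightarrow> m \<le> real (N u n w)) \<Longrightarrow>
      emeasure P {w \<in> space P. \<eta> * real (N u n w) \<le> \<bar>S u n w - mean u (\<theta> $ u) * real (N u n w)\<bar>}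
        \<le> ennreal (2 * exp (- I * m))"
proof -
  define s where "s = \<theta> $ u"
  have s: "s \<in> nat_params u" using \<theta> by (simp add: s_def param_space_def)
  obtain l I where lI: "0 < l" "0 < I" "s + l \<in> nat_params u" "s - l \<in> nat_params u"
    "bregman u s (s + l) \<le> l * \<eta> - I" "bregman u s (s - l) \<le> l * \<eta> - I"
    by (rule chernoff_rate[OF s assms(2)])
  define E where "E t n w = exp ((t - s) * S u n w - real (N u n w) * (log_partition u t - log_partition u s))"
    for t n w
  have E_borel [measurable]: "E t n \<in> borel_measurable P" for t n
    unfolding E_def by measurable
  have "emeasure P {w \<in> space P. \<eta> * real (N u n w) \<le> \<bar>S u n w - mean u s * real (N u n w)\<bar>}
      \<le> ennreal (2 * exp (- I * m))" (is "emeasure P ?A \<le> _")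
    if m: "\<And>w. w \<in> space P \<Longrightarrow> m \<le> real (N u n w)" for n m
  proof -
    \<comment> \<open>The sign of the deviation decides which tilt is large: \<open>s + l\<close>
      above the mean, \<open>s - l\<close> below it.\<close>
    have pointwise: "exp (I * m) \<le> E (s + l) n w + E (s - l) n w" if w: "w \<in> ?A" for w
    proof -
      let ?N = "real (N u n w)" and ?d = "S u n w - mean u s * real (N u n w)"
      have E_eq: "E t n w = exp ((t - s) * ?d - ?N * bregman u s t)" for t
        by (simp add: E_def bregman_def algebra_simps)
      have main: "I * m \<le> l * \<bar>?d\<bar> - ?N * b" if "b \<le> l * \<eta> - I" for b
      proof -
        have "I * m \<le> I * ?N" using m w lI(2) by (intro mult_left_mono) auto
        moreover have "?N * b \<le> ?N * (l * \<eta> - I)" using that by (intro mult_left_mono) auto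
        moreover have "l * (\<eta> * ?N) \<le> l * \<bar>?d\<bar>" using w lI(1) by (intro mult_left_mono) auto
        ultimately show ?thesis by (simp add: algebra_simps)
      qed
      show ?thesis
      proof (cases "0 \<le> ?d")
        case True
        then have "exp (I * m) \<le> E (s + l) n w" using main[OF lI(5)] by (simp add: E_eq)
        then show ?thesis by (simp add: E_def add_increasing2)
      next
        case False
        then have "exp (I * m) \<le> E (s - l) n w" using main[OF lI(6)] by (simp add: E_eq algebra_simps)
        then show ?thesis by (simp add: E_def add_increasing)
      qed
    qed
    have "emeasure P ?A = (\<integral>\<^sup>+w. indicator ?A w \<partial>P)" by (subst nn_integral_indicator) auto
    also have "\<dots> \<le> (\<integral>\<^sup>+w. ennreal (exp (- I * m)) * (ennreal (E (s + l) n w) + ennreal (E (s - l) n w)) \<partial>P)"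
    proof (rule nn_integral_mono)
      fix w
      have "1 \<le> exp (- I * m) * (E (s + l) n w + E (s - l) n w)" if "w \<in> ?A"
        using pointwise[OF that] by (simp add: exp_minus field_simps)
      then have "w \<in> ?A \<Longrightarrow> 1 \<le> ennreal (exp (- I * m) * (E (s + l) n w + E (s - l) n w))"
        by (simp flip: ennreal_1 add: ennreal_leI)
      then show "indicator ?A w \<le> ennreal (exp (- I * m)) * (ennreal (E (s + l) n w) + ennreal (E (s - l) n w))"
        by (simp add: E_def indicator_def ennreal_mult)
    qed
    also have "\<dots> = ennreal (exp (- I * m)) * (1 + 1)"
      using exp_martingale[OF lI(3), of n] exp_martingale[OF lI(4), of n]
      by (simp add: nn_integral_cmult nn_integral_add E_def s_def)
    also have "\<dots> = ennreal (2 * exp (- I * m))"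
      by (simp add: ennreal_mult mult.commute flip: ennreal_numeral)
    finally show ?thesis .
  qed
  then show ?thesis using that lI(2) unfolding s_def by blast
qed

text \<open>A density vanishes only where \<open>h u\<close> does, independently of the parameter,
  and an observation under \<open>u\<close> almost surely avoids that set. One null set hence serves
  all times and parameters.\<close>

lemma AE_lik_pos: "AE w in P. \<forall>n t. 0 < lik n w t"
proof -
  have "AE w in P. \<not> (U n w = u \<and> Y n w \<in> {y \<in> space \<mu>. h u y = 0})" if n: "1 \<le> n" for n u
  proof -
    let ?B = "{y \<in> space \<mu>. h u y = 0}"
    note [measurable] = Y_measurable[OF n] U_measurable[OF n] h_measurable[of u]
    have B [measurable]: "?B \<in> sets \<mu>" by measurable
    have "emeasure (density \<mu> (\<lambda>y. ennreal (obs_density \<theta> u y))) ?B = 0"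
      by (subst emeasure_density[OF obs_density_measurable B], subst nn_integral_0_iff_AE)
         (use obs_density_measurable in \<open>auto simp: obs_density_def indicator_def\<close>)
    moreover have "emeasure P (space P \<inter> {w \<in> space P. U n w = u \<and> Y n w \<in> ?B}) =
        emeasure P (space P \<inter> {w \<in> space P. U n w = u}) *
        emeasure (density \<mu> (\<lambda>y. ennreal (obs_density \<theta> u y))) ?B"
      using n sets.top[of "history P \<mu> U Y (n - 1)"] by (intro Y_conditional_law B) simp_all
    moreover have "space P \<inter> {w \<in> space P. U n w = u \<and> Y n w \<in> ?B} =
        {w \<in> space P. U n w = u \<and> Y n w \<in> ?B}" by blast
    ultimately have "emeasure P {w \<in> space P. U n w = u \<and> Y n w \<in> ?B} = 0" by (simp only: mult_zero_right)
    moreover have "{w \<in> space P. U n w = u \<and> Y n w \<in> ?B} \<in> sets P" by measurable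
    ultimately show ?thesis by (intro AE_I[of _ _ "{w \<in> space P. U n w = u \<and> Y n w \<in> ?B}"]) blast+
  qed
  then have "AE w in P. \<forall>u\<in>UNIV. \<not> (U n w = u \<and> Y n w \<in> {y \<in> space \<mu>. h u y = 0})"
    if "n \<in> {1..}" for n
    using that by (subst AE_ball_countable) (simp_all add: countable_finite)
  then have "AE w in P. \<forall>n\<in>{1..}. \<forall>u\<in>UNIV. \<not> (U n w = u \<and> Y n w \<in> {y \<in> space \<mu>. h u y = 0})"
    by (subst AE_ball_countable) simp_all
  then show ?thesis
    using AE_space
  proof eventually_elim
    case (elim w)
    have "0 < h u (Y k w)" if "k \<in> {1..n}" "U k w = u" for k n u
      using elim that measurable_space[OF Y_measurable, of k w] h_nonneg[of "Y k w" u]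
      by (auto simp: less_le)
    then show ?case
      by (auto simp: lik_def obs_density_def intro!: prod_pos mult_pos_pos)
  qed
qed

end

section \<open>Tracking and estimation\<close>

lemma explore_eps_eq: "explore_eps K k = 1 / (2 * sqrt (real K ^ 2 + real k))"
  by (simp add: explore_eps_def powr_minus powr_half_sqrt field_simps)

lemma explore_eps_antimono: "0 < K \<Longrightarrow> i \<le> k \<Longrightarrow> explore_eps K k \<le> explore_eps K i"
  unfolding explore_eps_eq by (intro divide_left_mono mult_left_mono mult_pos_pos) (auto simp: add_pos_nonneg)

lemma explore_eps_pos: "0 < K \<Longrightarrow> 0 < explore_eps K k"
  by (simp add: explore_eps_eq add_pos_nonneg)

lemma explore_eps_le: "0 < K \<Longrightarrow> explore_eps K k \<le> 1 / real K"
  using explore_eps_antimono[of K 0 k] by (simp add: explore_eps_eq field_simps)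

lemma explore_eps_tendsto: "explore_eps K \<longlonglongrightarrow> 0"
  unfolding explore_eps_eq by real_asymp

context proposed_policy
begin

lemma plug_in_\<Theta>:
  assumes "w \<in> space P"
  shows "plug_in k w \<in> (\<Union>m. \<Theta> m)"
proof (cases "k < CARD('u)")
  case True
  then show ?thesis using plug_in_init[OF _ assms] init_in by simp
next
  case False
  then have "CARD('u) \<le> k" by simp
  then have "plug_in k w \<in> \<Theta> (rec k w)"
    using plug_in_minimizer[OF _ assms] plug_in_no_minimizer[OF _ assms] unfolding is_arg_min_def by blast
  then show ?thesis by blast
qed

section \<open>Target proportions and tracking\<close>

definition alloc :: "nat \<Rightarrow> 'w \<Rightarrow> real ^ 'u" where
  "alloc k w = q_eps (explore_eps CARD('u) k) (plug_in k w)"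

lemma alloc_arg_min:
  assumes "w \<in> space P"
  shows "is_arg_min (\<lambda>q. infnorm (q - q_star (plug_in k w)))
    (\<lambda>q. q \<in> distributions \<and> (\<forall>u. q $ u \<in> {explore_eps CARD('u) k..1})) (alloc k w)"
  unfolding alloc_def
  by (intro q_eps_projection plug_in_\<Theta> assms explore_eps_pos explore_eps_le) simp_all

lemma alloc_distributions: "w \<in> space P \<Longrightarrow> alloc k w \<in> distributions"
  and alloc_ge: "w \<in> space P \<Longrightarrow> explore_eps CARD('u) k \<le> alloc k w $ u"
  using alloc_arg_min[of w k] by (auto simp: is_arg_min_def)

text \<open>The feasible competitor is a mixture of \<open>q_star\<close> with the uniform distribution.\<close>

lemma alloc_near:
  assumes "w \<in> space P"
  shows "\<bar>alloc k w $ u - q_star (plug_in k w) $ u\<bar> \<le> real CARD('u) * explore_eps CARD('u) k"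
proof -
  let ?\<epsilon> = "explore_eps CARD('u) k" and ?q = "q_star (plug_in k w)"
  have q: "?q \<in> distributions" using q_star_props(1)[OF q_star_unique[OF plug_in_\<Theta>[OF assms]]] .
  have \<epsilon>: "0 < ?\<epsilon>" "real CARD('u) * ?\<epsilon> \<le> 1"
    using explore_eps_pos[of "CARD('u)" k] explore_eps_le[of "CARD('u)" k] by (simp_all add: field_simps)
  define q' where "q' = (\<chi> u. (1 - real CARD('u) * ?\<epsilon>) * ?q $ u + ?\<epsilon>)"
  have "(\<Sum>u\<in>UNIV. q' $ u) = 1"
    using distributions_sum[OF q] by (simp add: q'_def sum.distrib flip: sum_distrib_left)
  moreover have ge: "?\<epsilon> \<le> q' $ u" for u
    using \<epsilon> distributions_nonneg[OF q] by (simp add: q'_def)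
  ultimately have q': "q' \<in> distributions"
    using \<epsilon>(1) by (auto simp: distributions_def intro: order_trans[OF less_imp_le])
  have "infnorm (q' - ?q) \<le> real CARD('u) * ?\<epsilon>"
    unfolding infnorm_cart
  proof (rule cSup_least)
    fix x assume "x \<in> {\<bar>(q' - ?q) $ i\<bar> |i. i \<in> UNIV}"
    then obtain i where "x = \<bar>(q' - ?q) $ i\<bar>" by blast
    then have x: "x = \<bar>?\<epsilon> - real CARD('u) * ?\<epsilon> * ?q $ i\<bar>" by (simp add: q'_def algebra_simps)
    have "real CARD('u) * ?\<epsilon> * ?q $ i \<le> real CARD('u) * ?\<epsilon> * 1"
      using \<epsilon> distributions_le_1[OF q] by (intro mult_left_mono) auto
    moreover have "0 \<le> real CARD('u) * ?\<epsilon> * ?q $ i" using \<epsilon> distributions_nonneg[OF q] by simp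
    moreover have "1 * ?\<epsilon> \<le> real CARD('u) * ?\<epsilon>" using \<epsilon> by (intro mult_right_mono) (simp_all add: Suc_leI)
    ultimately show "x \<le> real CARD('u) * ?\<epsilon>" unfolding x using \<epsilon>(1) by linarith
  qed auto
  moreover have "infnorm (alloc k w - ?q) \<le> infnorm (q' - ?q)"
    using alloc_arg_min[OF assms, of k] q' ge distributions_le_1[OF q'] by (auto simp: is_arg_min_def not_less)
  ultimately show ?thesis
    using component_le_infnorm_cart[of "alloc k w - ?q" u] by simp
qed

text \<open>Targets and counts both sum to \<open>n\<close>, so the deficits \<open>d\<close> sum to
  zero and the chosen control, having the largest one, has a nonnegative deficit. A pull therefore
  overshoots by at most one.\<close>

lemma tracking:
  assumes w: "w \<in> space P" and "CARD('u) \<le> n"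
  shows "real (N u n w) \<le> (\<Sum>k=1..n. alloc k w $ u) + 1"
  using \<open>CARD('u) \<le> n\<close>
proof (induction n arbitrary: u rule: nat_induct_at_least)
  case base
  have bij: "bij_betw (\<lambda>k. U k w) {1..CARD('u)} UNIV" by (rule initial_controls[OF w])
  then have "u \<in> (\<lambda>k. U k w) ` {1..CARD('u)}" unfolding bij_betw_def by simp
  then obtain k0 where "k0 \<in> {1..CARD('u)}" "u = U k0 w" by (rule imageE)
  then have "{k \<in> {1..CARD('u)}. U k w = u} = {k0}"
    using inj_on_eq_iff[OF bij_betw_imp_inj_on[OF bij]] by blast
  then have "N u CARD('u) w = 1" by (simp add: N_def)
  then show ?case using distributions_nonneg[OF alloc_distributions[OF w]] by (simp add: sum_nonneg)
next
  case (Suc n)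
  define d where "d v = (\<Sum>k=1..n. alloc k w $ v) - real (N v n w)" for v
  have nonneg: "0 \<le> alloc (Suc n) w $ u" using distributions_nonneg[OF alloc_distributions[OF w]] .
  show ?case
  proof (cases "U (Suc n) w = u")
    case True
    have "d v \<le> d u" for v
      using control_law[OF Suc.hyps w] True by (auto simp: is_arg_max_def d_def alloc_def not_less)
    then have "(\<Sum>v\<in>UNIV. d v) \<le> (\<Sum>v\<in>(UNIV::'u set). d u)" by (intro sum_mono)
    moreover have "(\<Sum>v\<in>UNIV. d v) = (\<Sum>k=1..n. \<Sum>v\<in>UNIV. alloc k w $ v) - real n"
      unfolding d_def sum_subtractf sum_N by (subst sum.swap) simp
    moreover have "\<dots> = 0" using distributions_sum[OF alloc_distributions[OF w]] by simp
    ultimately have "0 \<le> d u" by (simp add: zero_le_mult_iff)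
    then show ?thesis using nonneg True by (simp add: d_def N_Suc)
  next
    case False
    then show ?thesis using Suc.IH[of u] nonneg by (simp add: N_Suc)
  qed
qed

text \<open>The other controls overshoot by at most one each and the totals agree, so the shortfall
  of \<open>u\<close> is at most the number of controls.\<close>

lemma N_ge_alloc:
  assumes w: "w \<in> space P" and "CARD('u) \<le> n"
  shows "(\<Sum>k=1..n. alloc k w $ u) - real CARD('u) \<le> real (N u n w)"
proof -
  have "(\<Sum>v\<in>UNIV - {u}. real (N v n w)) \<le> (\<Sum>v\<in>UNIV - {u}. (\<Sum>k=1..n. alloc k w $ v) + 1)"
    by (intro sum_mono tracking assms)
  moreover have "(\<Sum>v\<in>UNIV. real (N v n w)) = real (N u n w) + (\<Sum>v\<in>UNIV - {u}. real (N v n w))"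
    by (subst sum.remove[of _ u]) simp_all
  moreover have "(\<Sum>v\<in>UNIV. (\<Sum>k=1..n. alloc k w $ v) + 1) = ((\<Sum>k=1..n. alloc k w $ u) + 1)
      + (\<Sum>v\<in>UNIV - {u}. (\<Sum>k=1..n. alloc k w $ v) + 1)"
    by (subst sum.remove[of _ u]) simp_all
  moreover have "(\<Sum>v\<in>UNIV. (\<Sum>k=1..n. alloc k w $ v) + 1) = real n + real CARD('u)"
    using distributions_sum[OF alloc_distributions[OF w]]
    by (simp add: sum.distrib) (subst sum.swap, simp)
  ultimately show ?thesis unfolding sum_N by linarith
qed

text \<open>The lower bound is of order sqrt n and holds on every path, as
  \<open>deviation_bound\<close> demands.\<close>

lemma forced_exploration:
  assumes w: "w \<in> space P" and "CARD('u) \<le> n"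
  shows "real n * explore_eps CARD('u) n - real CARD('u) \<le> real (N u n w)"
proof -
  have "(\<Sum>k=1..n. explore_eps CARD('u) n) \<le> (\<Sum>k=1..n. alloc k w $ u)"
    by (intro sum_mono order_trans[OF explore_eps_antimono alloc_ge[OF w]]) auto
  then show ?thesis using N_ge_alloc[OF assms, of u] by simp
qed

text \<open>Given the likelihood equation, the log-likelihood falls short of its value at
  \<open>t\<close> exactly by \<open>gap\<close>, a weighted sum of divergences. Nonnegativity makes
  \<open>t\<close> a maximizer, which activates the specification of \<open>mle\<close>; positivity
  off the diagonal makes it the only one.\<close>

lemma mle_eq:
  assumes w: "w \<in> space P" and n: "CARD('u) \<le> n" and pos: "0 < lik n w t"
    and t: "t \<in> param_space" and S_eq: "\<And>u. S u n w = mean u (t $ u) * real (N u n w)"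
    and N_pos: "\<And>u. 0 < N u n w"
  shows "mle n w = t"
proof -
  define gap where "gap x = (\<Sum>u\<in>UNIV. real (N u n w) * bregman u (t $ u) (x $ u))" for x
  have lik_eq: "lik n w x = lik n w t * exp (- gap x)" for x
    unfolding lik_ratio[of n w x t] gap_def sum_negf[symmetric]
    by (intro arg_cong[where f="\<lambda>z. lik n w t * exp z"] sum.cong) (auto simp: S_eq bregman_def algebra_simps)
  have term_nonneg: "0 \<le> real (N u n w) * bregman u (t $ u) (x $ u)" if "x \<in> param_space" for x u
    using that t by (simp add: param_space_def bregman_nonneg)
  have "lik n w x \<le> lik n w t" if "x \<in> param_space" for x
  proof -
    have "0 \<le> gap x" unfolding gap_def by (intro sum_nonneg term_nonneg that)
    then show ?thesis unfolding lik_eq[of x] using pos by simp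
  qed
  then have "is_arg_max (lik n w) (\<lambda>t. t \<in> param_space) t"
    using t by (force simp: is_arg_max_def not_less)
  then have "is_arg_max (lik n w) (\<lambda>t. t \<in> param_space) (mle n w)" using mle[OF n w] by blast
  then have m: "mle n w \<in> param_space" "lik n w t \<le> lik n w (mle n w)"
    using t by (auto simp: is_arg_max_def not_less)
  then have "gap (mle n w) \<le> 0" unfolding lik_eq[of "mle n w"] using pos by simp
  then have "gap (mle n w) = 0"
    unfolding gap_def by (intro antisym sum_nonneg term_nonneg m)
  then have "real (N u n w) * bregman u (t $ u) (mle n w $ u) = 0" for u
    unfolding gap_def by (subst (asm) sum_nonneg_eq_0_iff) (use term_nonneg m in auto)
  then have "bregman u (t $ u) (mle n w $ u) = 0" for u
    using N_pos[of u] by (simp add: mult_eq_0_iff) (metis less_numeral_extra(3))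
  then have "mle n w $ u = t $ u" for u
    using bregman_pos[of "t $ u" u "mle n w $ u"] t m by (force simp: param_space_def)
  then show ?thesis by (simp add: vec_eq_iff)
qed

lemma plug_in_near:
  assumes \<theta>: "\<theta> \<in> \<Theta> m" and "0 < r"
  obtains \<eta> where "0 < \<eta>"
    "\<And>n w. w \<in> space P \<Longrightarrow> CARD('u) \<le> n \<Longrightarrow> (\<And>t. 0 < lik n w t) \<Longrightarrow>
      (\<And>u. \<bar>S u n w - mean u (\<theta> $ u) * real (N u n w)\<bar> < \<eta> * real (N u n w)) \<Longrightarrow>
      plug_in n w \<in> \<Theta> m \<and> dist (plug_in n w) \<theta> < r"
proof -
  obtain c C where cC: "0 < c" "0 < C" "\<And>x. c * norm x \<le> nrm x" "\<And>x. nrm x \<le> C * norm x"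
    using is_norm_equivalent[OF nrm] by metis
  obtain r0 where r0: "0 < r0" "\<And>m' t. m' \<noteq> m \<Longrightarrow> t \<in> \<Theta> m' \<Longrightarrow> r0 \<le> nrm (\<theta> - t)"
    using \<Theta>_separated[OF \<theta>] by metis
  \<comment> \<open>Half the separation fixes the recommended hypothesis. The other bound accounts
    for the plug-in, which lies within \<open>\<rho>\<close> times the error of the estimate from
    it, and for the change of norm.\<close>
  define r1 where "r1 = min (r0 / 2) (c * r / (1 + \<rho>))"
  have r1: "0 < r1" using r0 cC \<open>0 < r\<close> rho_gt_1 by (simp add: r1_def)
  \<comment> \<open>Coordinate errors below \<open>\<epsilon>\<close> add up to an error below
    \<open>r1\<close> in \<open>nrm\<close>, via the sum of absolute values.\<close>
  define \<epsilon> where "\<epsilon> = r1 / (C * real CARD('u))"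
  have \<epsilon>: "0 < \<epsilon>" using r1 cC by (simp add: \<epsilon>_def)
  have nat: "\<theta> $ u \<in> nat_params u" for u using \<theta> \<Theta>_subset by (auto simp: param_space_def)
  have "\<forall>u. \<exists>\<eta>>0. \<forall>\<kappa>. \<bar>\<kappa> - mean u (\<theta> $ u)\<bar> < \<eta> \<longrightarrow>
      (\<exists>t\<in>nat_params u. \<bar>t - \<theta> $ u\<bar> < \<epsilon> \<and> mean u t = \<kappa>)"
    by (meson maximizer_near[OF nat \<epsilon>])
  then obtain e where e: "\<And>u. 0 < e u" "\<And>u \<kappa>. \<bar>\<kappa> - mean u (\<theta> $ u)\<bar> < e u \<Longrightarrow>
      \<exists>t\<in>nat_params u. \<bar>t - \<theta> $ u\<bar> < \<epsilon> \<and> mean u t = \<kappa>" by metis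
  define \<eta> where "\<eta> = Min (range e)"
  have "0 < \<eta>" using e(1) by (simp add: \<eta>_def)
  have \<eta>_le: "\<eta> \<le> e u" for u by (simp add: \<eta>_def)
  have "plug_in n w \<in> \<Theta> m \<and> dist (plug_in n w) \<theta> < r"
    if w: "w \<in> space P" and n: "CARD('u) \<le> n" and pos: "\<And>t. 0 < lik n w t"
      and good: "\<And>u. \<bar>S u n w - mean u (\<theta> $ u) * real (N u n w)\<bar> < \<eta> * real (N u n w)" for n w
  proof -
    \<comment> \<open>The strict inequality in \<open>good\<close> fails for an unpulled control,
      where both sides are zero.\<close>
    have N_pos: "0 < N u n w" for u
      using good[of u] \<open>0 < \<eta>\<close> by (cases "N u n w") auto
    have "\<exists>t\<in>nat_params u. \<bar>t - \<theta> $ u\<bar> < \<epsilon> \<and> mean u t = S u n w / real (N u n w)" for u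
    proof (rule e(2))
      have "S u n w / real (N u n w) - mean u (\<theta> $ u) =
          (S u n w - mean u (\<theta> $ u) * real (N u n w)) / real (N u n w)"
        using N_pos[of u] by (simp add: field_simps)
      then have "\<bar>S u n w / real (N u n w) - mean u (\<theta> $ u)\<bar> < \<eta>"
        using good[of u] N_pos[of u] by (simp add: abs_divide pos_divide_less_eq)
      then show "\<bar>S u n w / real (N u n w) - mean u (\<theta> $ u)\<bar> < e u" using \<eta>_le[of u] by simp
    qed
    then obtain f where f: "\<And>u. f u \<in> nat_params u" "\<And>u. \<bar>f u - \<theta> $ u\<bar> < \<epsilon>"
      "\<And>u. mean u (f u) = S u n w / real (N u n w)" by metis
    have "mle n w = (\<chi> u. f u)"
      using f N_pos by (intro mle_eq[OF w n pos]) (auto simp: param_space_def)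
    then have "\<bar>(mle n w - \<theta>) $ u\<bar> < \<epsilon>" for u using f(2) by simp
    then have "(\<Sum>u\<in>UNIV. \<bar>(mle n w - \<theta>) $ u\<bar>) < (\<Sum>u\<in>(UNIV::'u set). \<epsilon>)"
      by (intro sum_strict_mono) auto
    then have "norm (mle n w - \<theta>) < real CARD('u) * \<epsilon>" using norm_le_l1_cart[of "mle n w - \<theta>"] by simp
    then have "C * norm (mle n w - \<theta>) < C * (real CARD('u) * \<epsilon>)" using cC(2) by (intro mult_strict_left_mono)
    also have "C * (real CARD('u) * \<epsilon>) = r1" using cC(2) by (simp add: \<epsilon>_def)
    finally have mle_near: "nrm (mle n w - \<theta>) < r1" using cC(4)[of "mle n w - \<theta>"] by simp
    have rec_eq: "rec n w = m"
    proof (rule nearest_hypothesis[OF \<theta>])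
      show "r0 \<le> nrm (\<theta> - t)" if "m' \<noteq> m" "t \<in> \<Theta> m'" for m' t using r0(2) that .
      show "nrm (mle n w - \<theta>) < r0 / 2" using mle_near by (simp add: r1_def)
    qed (rule recommendation[OF n w])
    have dist_le: "dist_to nrm (mle n w) (\<Theta> m) \<le> nrm (mle n w - \<theta>)" by (rule dist_to_le[OF \<theta>])
    have nonneg: "0 \<le> nrm x" for x using nrm by (simp add: is_norm_def)
    have plug: "plug_in n w \<in> \<Theta> m \<and> nrm (plug_in n w - mle n w) \<le> \<rho> * nrm (mle n w - \<theta>)"
    proof (cases "\<exists>t. is_arg_min (\<lambda>t. nrm (t - mle n w)) (\<lambda>t. t \<in> \<Theta> (rec n w)) t")
      case True
      from plug_in_minimizer[OF n w this]
      have "plug_in n w \<in> \<Theta> m" "nrm (plug_in n w - mle n w) \<le> nrm (\<theta> - mle n w)"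
        using \<theta> rec_eq by (auto simp: is_arg_min_def not_less)
      moreover have "nrm (mle n w - \<theta>) \<le> \<rho> * nrm (mle n w - \<theta>)"
        using rho_gt_1 nonneg[of "mle n w - \<theta>"] by (simp add: mult_le_cancel_right1)
      ultimately show ?thesis using nrm_commute[of \<theta> "mle n w"] by simp
    next
      case False
      from plug_in_no_minimizer[OF n w this]
      have "plug_in n w \<in> \<Theta> m" "nrm (plug_in n w - mle n w) \<le> \<rho> * dist_to nrm (mle n w) (\<Theta> m)"
        using rec_eq by auto
      moreover have "\<rho> * dist_to nrm (mle n w) (\<Theta> m) \<le> \<rho> * nrm (mle n w - \<theta>)"
        using dist_le rho_gt_1 by (intro mult_left_mono) auto
      ultimately show ?thesis by simp
    qed
    have "c * norm (plug_in n w - \<theta>) \<le> nrm (plug_in n w - \<theta>)" by (rule cC(3))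
    also have "\<dots> \<le> nrm (plug_in n w - mle n w) + nrm (mle n w - \<theta>)" by (rule nrm_triangle)
    also have "\<dots> \<le> (1 + \<rho>) * nrm (mle n w - \<theta>)" using plug by (simp add: algebra_simps)
    also have "\<dots> < (1 + \<rho>) * r1" using mle_near rho_gt_1 by (intro mult_strict_left_mono) auto
    also have "\<dots> \<le> (1 + \<rho>) * (c * r / (1 + \<rho>))"
      using rho_gt_1 by (intro mult_left_mono) (auto simp: r1_def)
    also have "\<dots> = c * r" using rho_gt_1 by simp
    finally show ?thesis using plug cC(1) by (simp add: dist_norm)
  qed
  with \<open>0 < \<eta>\<close> show ?thesis using that by blast
qed

end

section \<open>Growth of the test statistic and expected stopping time\<close>

lemma sqrt_le_one_plus: "0 \<le> x \<Longrightarrow> sqrt x \<le> 1 + x"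
  by (rule real_le_lsqrt) (auto simp: power2_eq_square algebra_simps)

lemma thr_v_sublinear:
  assumes "0 < \<delta>"
  shows "\<forall>\<^sub>F n in sequentially. thr_v K n \<le> \<delta> * real n"
proof -
  \<comment> \<open>\<open>K + 3\<close> bounds the logarithmic argument \<open>L\<close> by a
    multiple of \<open>ln n\<close>, because \<open>ln (1 + ln n) \<le> ln n\<close>;
    \<open>1 + 4 K\<close> and the extra 1 in \<open>a\<close> come from bounding the square root by
    \<open>1 + 4 K L\<close>.\<close>
  define a b where "a = thr_C K + 1" and "b = (1 + 4 * real K) * (real K + 3)"
  have "(\<lambda>n. a / real n + b * (ln (real n) / real n)) \<longlonglongrightarrow> 0 + b * 0"
    by (intro tendsto_add tendsto_mult tendsto_const lim_ln_over_n lim_const_over_n)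
  then have "\<forall>\<^sub>F n in sequentially. a / real n + b * (ln (real n) / real n) < \<delta>"
    using assms by (intro order_tendstoD(2)) simp_all
  then show ?thesis
    using eventually_gt_at_top[of 0]
  proof eventually_elim
    case (elim n)
    define L where "L = ln (real n * (1 + ln (real n)) ^ (K + 2))"
    have ln: "0 \<le> ln (real n)" using elim by (simp add: Suc_leI)
    have "0 < 1 + ln (real n)" using ln by simp
    then have "1 + ln (real n) \<noteq> 0" by linarith
    with \<open>0 < 1 + ln (real n)\<close> have "L = ln (real n) + (real K + 2) * ln (1 + ln (real n))"
      using elim by (simp add: L_def ln_mult ln_realpow del: power_Suc power_add_numeral)
    moreover have "0 \<le> ln (1 + ln (real n))" "ln (1 + ln (real n)) \<le> ln (real n)"
      using ln ln_add_one_self_le_self by auto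
    ultimately have L: "0 \<le> L" "L \<le> (real K + 3) * ln (real n)"
      using ln mult_left_mono[of "ln (1 + ln (real n))" "ln (real n)" "real K + 2"]
      by (auto simp: algebra_simps)
    have "thr_v K n = thr_C K + L + sqrt (4 * real K * L)" by (simp add: thr_v_def L_def)
    also have "\<dots> \<le> a + (1 + 4 * real K) * L"
      using sqrt_le_one_plus[of "4 * real K * L"] L(1) by (simp add: a_def algebra_simps)
    also have "\<dots> \<le> a + b * ln (real n)"
      using mult_left_mono[OF L(2), of "1 + 4 * real K"] by (simp add: b_def mult.assoc)
    also have "\<dots> = (a / real n + b * (ln (real n) / real n)) * real n"
      using elim by (simp add: field_simps)
    also have "\<dots> \<le> \<delta> * real n" using elim by (intro mult_right_mono) auto
    finally show ?case .
  qed
qed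

text \<open>The inequality of arithmetic and geometric means: the square root costs an arbitrarily
  small fraction of the leading term and a constant.\<close>

lemma thr_w_le:
  assumes "0 < \<delta>"
  shows "thr_w K \<alpha> \<le> (1 + \<delta>) * \<bar>ln \<alpha>\<bar> + real K / \<delta>"
proof -
  have "0 \<le> (\<delta> * \<bar>ln \<alpha>\<bar> - real K / \<delta>)\<^sup>2" by simp
  also have "\<dots> = (\<delta> * \<bar>ln \<alpha>\<bar> + real K / \<delta>)\<^sup>2 - 4 * real K * \<bar>ln \<alpha>\<bar>"
    using assms by (simp add: power2_eq_square field_simps)
  finally have "sqrt (4 * real K * \<bar>ln \<alpha>\<bar>) \<le> \<delta> * \<bar>ln \<alpha>\<bar> + real K / \<delta>"
    using assms by (intro real_le_lsqrt) auto
  then show ?thesis by (simp add: thr_w_def algebra_simps)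
qed

lemma threshold_le:
  assumes "0 < \<delta>"
  obtains n0 where "\<And>n \<alpha>. n0 \<le> n \<Longrightarrow> threshold K n \<alpha> \<le> \<delta> * real n + (1 + \<delta>) * \<bar>ln \<alpha>\<bar> + real K / \<delta>"
proof -
  obtain n0 where "\<And>n. n0 \<le> n \<Longrightarrow> thr_v K n \<le> \<delta> * real n"
    using thr_v_sublinear[OF assms] unfolding eventually_sequentially by blast
  then show ?thesis
    using thr_w_le[OF assms, of K] by (intro that[of n0]) (auto simp: threshold_def add.assoc intro!: add_mono)
qed

context controlled_sampling
begin

text \<open>The bound \<open>B\<close> only keeps the real supremum over the own hypothesis
  meaningful; its size does not enter. Positivity of the likelihood makes the denominator
  positive.\<close>

lemma Z_ge:
  assumes \<theta>: "\<theta> \<in> \<Theta> m" and pos: "\<And>t. 0 < lik n w t"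
    and own: "\<And>t. t \<in> \<Theta> m \<Longrightarrow> lik n w t \<le> B"
    and other: "\<And>m' t. m' \<noteq> m \<Longrightarrow> t \<in> \<Theta> m' \<Longrightarrow> lik n w t \<le> lik n w \<theta> * exp (- x)"
  shows "ereal x \<le> Z n w"
proof -
  have "ereal x \<le> Zhyp m n w"
    unfolding Zhyp_def
  proof (rule INF_greatest)
    fix j assume "j \<in> UNIV - {m}"
    then have j: "j \<noteq> m" by simp
    let ?a = "SUP t\<in>\<Theta> m. lik n w t" and ?b = "SUP t\<in>\<Theta> j. lik n w t"
    have a: "lik n w \<theta> \<le> ?a"
      by (intro cSUP_upper \<theta> bdd_aboveI2[of _ _ B] own)
    have b: "?b \<le> lik n w \<theta> * exp (- x)"
      by (intro cSUP_least \<Theta>_nonempty other[OF j])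
    obtain t where t: "t \<in> \<Theta> j" using \<Theta>_nonempty by blast
    have "lik n w t \<le> ?b"
      by (intro cSUP_upper t bdd_aboveI2[of _ _ "lik n w \<theta> * exp (- x)"] other[OF j])
    then have b_pos: "0 < ?b" using pos[of t] by linarith
    have "exp x * ?b \<le> lik n w \<theta>"
      using b by (simp add: exp_minus field_simps)
    then have "exp x \<le> ?a / ?b" using a b_pos by (simp add: pos_le_divide_eq)
    then have "x \<le> ln (?a / ?b)" by (metis exp_gt_zero ln_exp ln_mono order_less_le_trans)
    then show "ereal x \<le> ereal (Zpair m j n w)" by (simp add: Zpair_def)
  qed
  also have "\<dots> \<le> Z n w" unfolding Z_def by (intro SUP_upper) simp
  finally show ?thesis .
qed

end

context proposed_policy
begin

text \<open>The inequality is not strict, so a time at which some control is still unpulled counts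
  as deviating.\<close>

definition deviates :: "real \<Rightarrow> nat \<Rightarrow> 'w \<Rightarrow> bool" where
  "deviates \<eta> k w \<longleftrightarrow>
     (\<exists>u. \<eta> * real (N u k w) \<le> \<bar>S u k w - mean u (\<theta> $ u) * real (N u k w)\<bar>)"

text \<open>The maximizer being unique, the allocations of the good times all lie near \<open>q_star \<theta>\<close>,
  so the pulls dominate \<open>(1 - s) n q_star \<theta>\<close> coordinatewise.\<close>

lemma pulls_ge:
  assumes \<theta>: "\<theta> \<in> \<Theta> m" and s: "0 < s" "s < 1"
  obtains \<eta> b where "0 < \<eta>" "0 \<le> b"
    "\<And>w n R u. w \<in> space P \<Longrightarrow> (\<And>n t. 0 < lik n w t) \<Longrightarrow> 0 \<le> R \<Longrightarrow>
      (\<And>k. CARD('u) \<le> k \<Longrightarrow> R < real k \<Longrightarrow> \<not> deviates \<eta> k w) \<Longrightarrow> b * (1 + R) \<le> real n \<Longrightarrow>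
      CARD('u) \<le> n \<and> R < real n \<and> real n * (1 - s) * q_star \<theta> $ u \<le> real (N u n w)"
proof -
  let ?q = "q_star \<theta>"
  have "\<theta> \<in> (\<Union>m. \<Theta> m)" using \<theta> by blast
  then have q: "?q \<in> distributions" by (intro q_star_props q_star_unique)
  \<comment> \<open>The smallest positive optimal proportion, which turns an absolute error into a
    relative one.\<close>
  define p where "p = Min (insert 1 ((\<lambda>u. ?q $ u) ` {u. 0 < ?q $ u}))"
  have "p \<in> insert 1 ((\<lambda>u. ?q $ u) ` {u. 0 < ?q $ u})"
    unfolding p_def by (intro Min_in) auto
  then have p: "0 < p" by auto
  have p_le: "p \<le> 1" "\<And>u. 0 < ?q $ u \<Longrightarrow> p \<le> ?q $ u" by (auto simp: p_def)
  \<comment> \<open>Three losses of size \<open>r\<close> occur: continuity of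
    \<open>q_star\<close>, projection onto the explored simplex, and the initial stretch together
    with the tracking error.\<close>
  define r where "r = s * p / 3"
  have "s * p \<le> s" using s p_le(1) by (simp add: mult_left_le)
  then have "s * p < 1" using s(2) by linarith
  then have r: "0 < r" "r < 1 / 3" using s p by (auto simp: r_def)
  obtain r' where r': "0 < r'" "\<And>t u. dist t \<theta> < r' \<Longrightarrow> t \<in> \<Theta> m \<Longrightarrow> \<bar>q_star t $ u - ?q $ u\<bar> < r"
    using q_star_near[OF \<theta> r(1) q_star_unique] unfolding eventually_nhds_metric by blast
  obtain \<eta> where \<eta>: "0 < \<eta>"
    "\<And>n w. w \<in> space P \<Longrightarrow> CARD('u) \<le> n \<Longrightarrow> (\<And>t. 0 < lik n w t) \<Longrightarrow>
      (\<And>u. \<bar>S u n w - mean u (\<theta> $ u) * real (N u n w)\<bar> < \<eta> * real (N u n w)) \<Longrightarrow>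
      plug_in n w \<in> \<Theta> m \<and> dist (plug_in n w) \<theta> < r'"
    by (rule plug_in_near[OF \<theta> r'(1)]) blast
  have "(\<lambda>k. real CARD('u) * explore_eps CARD('u) k) \<longlonglongrightarrow> real CARD('u) * 0"
    by (intro tendsto_mult tendsto_const explore_eps_tendsto)
  then have "\<forall>\<^sub>F k in sequentially. real CARD('u) * explore_eps CARD('u) k < r"
    using r(1) by (intro order_tendstoD(2)) simp_all
  then obtain k1 where k1: "\<And>k. k1 \<le> k \<Longrightarrow> real CARD('u) * explore_eps CARD('u) k < r"
    unfolding eventually_sequentially by blast
  \<comment> \<open>With this choice \<open>r * n\<close> covers \<open>R + 1 + k1\<close> and twice
    the number of controls, hence \<open>l\<close> below and the tracking error.\<close>
  define b where "b = (1 + real k1 + 2 * real CARD('u)) / r"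
  have "0 \<le> b" using r(1) by (simp add: b_def)
  moreover have "CARD('u) \<le> n \<and> R < real n \<and> real n * (1 - s) * ?q $ u \<le> real (N u n w)"
    if w: "w \<in> space P" and pos: "\<And>n t. 0 < lik n w t" and R: "0 \<le> R"
      and good: "\<And>k. CARD('u) \<le> k \<Longrightarrow> R < real k \<Longrightarrow> \<not> deviates \<eta> k w"
      and n: "b * (1 + R) \<le> real n" for w n R u
  proof -
    \<comment> \<open>After \<open>l\<close> the estimate is defined, no deviation occurs any more,
      and the projection error is below \<open>r\<close>.\<close>
    define l where "l = nat \<lceil>R\<rceil> + k1 + CARD('u)"
    have l: "real l \<le> R + 1 + real k1 + real CARD('u)" using R by (simp add: l_def)
    have "R + 1 + real k1 + 2 * real CARD('u) \<le> (1 + real k1 + 2 * real CARD('u)) * (1 + R)"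
      using R by (simp add: algebra_simps)
    also have "\<dots> = r * (b * (1 + R))" using r(1) by (simp add: b_def)
    also have "\<dots> \<le> r * real n" using n r(1) by (intro mult_left_mono) auto
    finally have rn: "R + 1 + real k1 + 2 * real CARD('u) \<le> r * real n" .
    also have "r * real n \<le> 1 * real n" using r(2) by (intro mult_right_mono) auto
    finally have big: "R < real n" "CARD('u) \<le> n" "l \<le> n" using R l by linarith+
    have "?q $ u - 2 * r \<le> alloc k w $ u" if "k \<in> {l + 1..n}" for k
    proof -
      have "R < real l + 1" by (simp add: l_def) linarith
      then have k: "CARD('u) \<le> k" "k1 \<le> k" "R < real k" using that by (auto simp: l_def)
      have "\<not> deviates \<eta> k w" by (rule good[OF k(1,3)])
      then have "plug_in k w \<in> \<Theta> m \<and> dist (plug_in k w) \<theta> < r'"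
        by (intro \<eta>(2)[OF w k(1) pos]) (auto simp: deviates_def not_le)
      then have "\<bar>q_star (plug_in k w) $ u - ?q $ u\<bar> < r" using r'(2) by blast
      then show ?thesis using alloc_near[OF w, of k u] k1[OF k(2)] by linarith
    qed
    then have "(\<Sum>k=l+1..n. ?q $ u - 2 * r) \<le> (\<Sum>k=l+1..n. alloc k w $ u)" by (intro sum_mono)
    also have "\<dots> \<le> (\<Sum>k=1..n. alloc k w $ u)"
      using distributions_nonneg[OF alloc_distributions[OF w]] by (intro sum_mono2) auto
    also have "\<dots> \<le> real (N u n w) + real CARD('u)" using N_ge_alloc[OF w big(2), of u] by simp
    finally have "(real n - real l) * (?q $ u - 2 * r) - real CARD('u) \<le> real (N u n w)"
      using big(3) by (simp add: of_nat_diff)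
    moreover have "real l * (?q $ u - 2 * r) \<le> real l * 1"
      using distributions_le_1[OF q, of u] r(1) by (intro mult_left_mono) auto
    ultimately have "real n * (?q $ u - 2 * r) - real l - real CARD('u) \<le> real (N u n w)"
      by (simp add: algebra_simps)
    then have lower: "real n * (?q $ u - 3 * r) \<le> real (N u n w)"
      using rn l by (simp add: algebra_simps)
    have "real n * (1 - s) * ?q $ u \<le> real (N u n w)"
    proof (cases "0 < ?q $ u")
      case True
      have "s * p \<le> s * ?q $ u" using p_le(2)[OF True] s by (intro mult_left_mono) auto
      then have "(1 - s) * ?q $ u \<le> ?q $ u - 3 * r" by (simp add: r_def algebra_simps)
      then have "real n * ((1 - s) * ?q $ u) \<le> real n * (?q $ u - 3 * r)" by (intro mult_left_mono) auto
      then show ?thesis using lower by simp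
    next
      case False
      then have "?q $ u = 0" using distributions_nonneg[OF q, of u] by simp
      then show ?thesis by simp
    qed
    with big show ?thesis by simp
  qed
  ultimately show ?thesis using \<eta>(1) that by blast
qed

lemma deviates_antimono: "\<eta> \<le> \<eta>' \<Longrightarrow> deviates \<eta>' k w \<Longrightarrow> deviates \<eta> k w"
  unfolding deviates_def by (meson mult_right_mono of_nat_0_le_iff order_trans)

lemma evidence_growth:
  assumes \<theta>: "\<theta> \<in> \<Theta> m" and d: "0 < d" "ereal d < D_star \<theta>"
  obtains \<eta> b where "0 < \<eta>" "0 \<le> b"
    "\<And>w n R. w \<in> space P \<Longrightarrow> (\<And>n t. 0 < lik n w t) \<Longrightarrow> 0 \<le> R \<Longrightarrow>
      (\<And>k. CARD('u) \<le> k \<Longrightarrow> R < real k \<Longrightarrow> \<not> deviates \<eta> k w) \<Longrightarrow> b * (1 + R) \<le> real n \<Longrightarrow>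
      ereal (real n * d) \<le> Z n w"
proof -
  let ?q = "q_star \<theta>"
  have "\<theta> \<in> (\<Union>m. \<Theta> m)" using \<theta> by blast
  note q = q_star_props[OF q_star_unique[OF this]]
  have params: "\<theta> \<in> param_space" using \<theta> \<Theta>_subset by blast
  then have nat: "\<theta> $ u \<in> nat_params u" for u by (simp add: param_space_def)
  obtain y where y: "d < y" "ereal y < D_star \<theta>" using ereal_dense2[OF d(2)] by auto
  \<comment> \<open>One factor \<open>1 - s\<close> is lost in the pulls; the other factor and the
    subtracted \<open>s\<close> are lost to the noise.\<close>
  have "((\<lambda>s. (1 - s) * (1 - s) * y - s) \<longlongrightarrow> (1 - 0) * (1 - 0) * y - 0) (at_right 0)"
    by (intro tendsto_intros)
  then have "\<forall>\<^sub>F s in at_right 0. d < (1 - s) * (1 - s) * y - s"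
    using y(1) by (intro order_tendstoD(1)) simp_all
  moreover have "\<forall>\<^sub>F s in at_right (0::real). s \<in> {0<..<1}" by (rule eventually_at_right_real) simp
  ultimately have "\<forall>\<^sub>F s in at_right 0. d < (1 - s) * (1 - s) * y - s \<and> s \<in> {0<..<1}"
    by (rule eventually_conj)
  from eventually_happens'[OF trivial_limit_at_right_real this]
  obtain s where s: "d < (1 - s) * (1 - s) * y - s" "0 < s" "s < 1" by auto
  have "\<forall>u. \<exists>c>0. \<forall>t\<in>nat_params u. \<bar>t - \<theta> $ u\<bar> \<le> c * (1 + bregman u (\<theta> $ u) t)"
    by (meson bregman_growth[OF nat])
  then obtain c where c: "\<And>u. 0 < c u"
    "\<And>u t. t \<in> nat_params u \<Longrightarrow> \<bar>t - \<theta> $ u\<bar> \<le> c u * (1 + bregman u (\<theta> $ u) t)" by metis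
  define C where "C = Max (range c)"
  have C_ge: "c u \<le> C" for u by (simp add: C_def)
  then have "0 < C" using c(1) by (meson less_le_trans)
  have growth: "\<bar>t $ u - \<theta> $ u\<bar> \<le> C * (1 + KL u \<theta> t)" if "t \<in> param_space" for t u
  proof -
    have "\<bar>t $ u - \<theta> $ u\<bar> \<le> c u * (1 + KL u \<theta> t)"
      using c(2) that by (simp add: param_space_def KL_eq_bregman)
    also have "\<dots> \<le> C * (1 + KL u \<theta> t)"
      using C_ge KL_nonneg[OF params that, of u] by (intro mult_right_mono) auto
    finally show ?thesis .
  qed
  obtain \<eta>1 b where \<eta>1: "0 < \<eta>1" and b: "0 \<le> b" and pulls:
    "\<And>w n R u. w \<in> space P \<Longrightarrow> (\<And>n t. 0 < lik n w t) \<Longrightarrow> 0 \<le> R \<Longrightarrow>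
      (\<And>k. CARD('u) \<le> k \<Longrightarrow> R < real k \<Longrightarrow> \<not> deviates \<eta>1 k w) \<Longrightarrow> b * (1 + R) \<le> real n \<Longrightarrow>
      CARD('u) \<le> n \<and> R < real n \<and> real n * (1 - s) * ?q $ u \<le> real (N u n w)"
    by (rule pulls_ge[OF \<theta> s(2,3)]) blast
  \<comment> \<open>The noise per pull is at most \<open>\<eta> * C * (1 + KL u \<theta> t)\<close>;
    the second bound makes this at most \<open>s * (1 + KL u \<theta> t)\<close>.\<close>
  define \<eta> where "\<eta> = min \<eta>1 (s / C)"
  have \<eta>: "0 < \<eta>" "\<eta> \<le> \<eta>1" "\<eta> * C \<le> s"
    using \<eta>1 s(2) \<open>0 < C\<close> by (auto simp: \<eta>_def min_def field_simps)
  have "ereal (real n * d) \<le> Z n w"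
    if w: "w \<in> space P" and pos: "\<And>n t. 0 < lik n w t" and R: "0 \<le> R"
      and good: "\<And>k. CARD('u) \<le> k \<Longrightarrow> R < real k \<Longrightarrow> \<not> deviates \<eta> k w"
      and n: "b * (1 + R) \<le> real n" for w n R
  proof -
    have "\<not> deviates \<eta>1 k w" if "CARD('u) \<le> k" "R < real k" for k
      using good[OF that] deviates_antimono[OF \<eta>(2)] by blast
    then have n': "CARD('u) \<le> n" "R < real n"
      and N_ge: "\<And>u. real n * (1 - s) * ?q $ u \<le> real (N u n w)"
      using pulls[OF w pos R _ n] by blast+
    have dev: "\<bar>S u n w - mean u (\<theta> $ u) * real (N u n w)\<bar> \<le> \<eta> * real (N u n w)" for u
      using good[OF n'] by (auto simp: deviates_def not_le intro: less_imp_le)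
    define G where "G t = (\<Sum>u\<in>UNIV. real (N u n w) * KL u \<theta> t)" for t
    have lik_le: "lik n w t \<le> lik n w \<theta> * exp (s * real n - (1 - s) * G t)" if t: "t \<in> param_space" for t
    proof -
      have "(t $ u - \<theta> $ u) * S u n w - real (N u n w) * (log_partition u (t $ u) - log_partition u (\<theta> $ u))
          \<le> s * real (N u n w) - (1 - s) * (real (N u n w) * KL u \<theta> t)" for u
      proof -
        let ?N = "real (N u n w)" and ?e = "S u n w - mean u (\<theta> $ u) * real (N u n w)"
        have KL: "0 \<le> KL u \<theta> t" by (rule KL_nonneg[OF params t])
        have "(t $ u - \<theta> $ u) * ?e \<le> \<bar>t $ u - \<theta> $ u\<bar> * \<bar>?e\<bar>" by (metis abs_ge_self abs_mult)
        also have "\<dots> \<le> (C * (1 + KL u \<theta> t)) * (\<eta> * ?N)"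
          using growth[OF t] dev KL \<open>0 < C\<close> by (intro mult_mono) auto
        also have "\<dots> = (\<eta> * C) * (?N * (1 + KL u \<theta> t))" by (simp add: algebra_simps)
        also have "\<dots> \<le> s * (?N * (1 + KL u \<theta> t))" using \<eta>(3) KL by (intro mult_right_mono) auto
        finally show ?thesis by (simp add: KL_def algebra_simps)
      qed
      then have "(\<Sum>u\<in>UNIV. (t $ u - \<theta> $ u) * S u n w
          - real (N u n w) * (log_partition u (t $ u) - log_partition u (\<theta> $ u)))
          \<le> (\<Sum>u\<in>UNIV. s * real (N u n w) - (1 - s) * (real (N u n w) * KL u \<theta> t))"
        by (intro sum_mono)
      also have "\<dots> = s * real n - (1 - s) * G t"
        by (simp add: sum_subtractf G_def sum_N flip: sum_distrib_left)
      finally show ?thesis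
        unfolding lik_ratio[of n w t \<theta>] using pos[of n \<theta>] by (intro mult_left_mono) auto
    qed
    show ?thesis
    proof (rule Z_ge[OF \<theta> pos])
      fix t assume "t \<in> \<Theta> m"
      then have t: "t \<in> param_space" using \<Theta>_subset by blast
      have "0 \<le> (1 - s) * G t"
        unfolding G_def using s KL_nonneg[OF params t] by (intro mult_nonneg_nonneg sum_nonneg) auto
      then have "exp (s * real n - (1 - s) * G t) \<le> exp (s * real n)" by simp
      then show "lik n w t \<le> lik n w \<theta> * exp (s * real n)"
        using lik_le[OF t] pos[of n \<theta>] by (meson mult_left_mono less_imp_le order_trans)
    next
      fix m' t assume m': "m' \<noteq> m" "t \<in> \<Theta> m'"
      then have t: "t \<in> param_space" using \<Theta>_subset by blast
      have "y \<le> cost \<theta> ?q t" using m' y(2) q(2) le_info_iff[OF \<theta>, of y ?q] by auto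
      then have "(1 - s) * (real n * (1 - s)) * y \<le> (1 - s) * (real n * (1 - s)) * cost \<theta> ?q t"
        using s by (intro mult_left_mono) auto
      also have "real n * (1 - s) * cost \<theta> ?q t \<le> G t"
        unfolding cost_def G_def sum_distrib_left mult.assoc[symmetric]
        using N_ge KL_nonneg[OF params t] by (intro sum_mono mult_right_mono) auto
      then have "(1 - s) * (real n * (1 - s)) * cost \<theta> ?q t \<le> (1 - s) * G t"
        using s by (simp add: mult.assoc)
      finally have "(1 - s) * (real n * (1 - s)) * y \<le> (1 - s) * G t" .
      moreover have "real n * d \<le> real n * ((1 - s) * (1 - s) * y - s)"
        using s(1) by (intro mult_left_mono) auto
      ultimately have "s * real n - (1 - s) * G t \<le> - (real n * d)" by (simp add: algebra_simps)
      then have "exp (s * real n - (1 - s) * G t) \<le> exp (- (real n * d))" by simp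
      then show "lik n w t \<le> lik n w \<theta> * exp (- (real n * d))"
        using lik_le[OF t] pos[of n \<theta>] by (meson mult_left_mono less_imp_le order_trans)
    qed
  qed
  then show ?thesis using \<eta>(1) b that by blast
qed

section \<open>Integrability of the deviation times\<close>

lemma deviates_borel [measurable]: "Measurable.pred P (deviates \<eta> k)"
  unfolding deviates_def by measurable

text \<open>A sum instead of the actual last time: it dominates that time, is visibly measurable,
  and its expectation is computed term by term.\<close>

definition last_deviation :: "real \<Rightarrow> 'w \<Rightarrow> ennreal" where
  "last_deviation \<eta> w = (\<Sum>k. ennreal (real k) * indicator {w. CARD('u) \<le> k \<and> deviates \<eta> k w} w)"

lemma last_deviation_borel [measurable]: "last_deviation \<eta> \<in> borel_measurable P"
  unfolding last_deviation_def by measurable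

lemma deviates_le_last:
  assumes "CARD('u) \<le> k" "deviates \<eta> k w"
  shows "ennreal (real k) \<le> last_deviation \<eta> w"
proof -
  have "(\<Sum>i\<in>{k}. ennreal (real i) * indicator {w. CARD('u) \<le> i \<and> deviates \<eta> i w} w) \<le> last_deviation \<eta> w"
    unfolding last_deviation_def by (intro sum_le_suminf) auto
  then show ?thesis using assms by simp
qed

lemma last_deviation_integrable:
  assumes \<theta>: "\<theta> \<in> param_space" and "0 < \<eta>"
  shows "(\<integral>\<^sup>+w. last_deviation \<eta> w \<partial>P) < \<infinity>"
proof -
  let ?m = "\<lambda>k. real k * explore_eps CARD('u) k - real CARD('u)"
  let ?A = "\<lambda>u k. {w \<in> space P. \<eta> * real (N u k w) \<le> \<bar>S u k w - mean u (\<theta> $ u) * real (N u k w)\<bar>}"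
  have "\<forall>u. \<exists>I>0. \<forall>k m. (\<forall>w\<in>space P. m \<le> real (N u k w)) \<longrightarrow>
      emeasure P (?A u k) \<le> ennreal (2 * exp (- I * m))"
    by (intro allI, rule deviation_bound[OF assms]) blast
  from choice[OF this] obtain I where I: "\<And>u. 0 < I u" "\<And>u k m. (\<forall>w\<in>space P. m \<le> real (N u k w)) \<Longrightarrow>
      emeasure P (?A u k) \<le> ennreal (2 * exp (- I u * m))" by blast
  define f where "f u k = 2 * (real k * exp (- I u * ?m k))" for u k
  have "summable (f u)" for u
  proof -
    \<comment> \<open>\<open>k * explore_eps K k\<close> grows like sqrt k / 2, so
      \<open>f u\<close> decays faster than any power.\<close>
    have "f u \<in> O(\<lambda>k. 1 / real k ^ 2)"
      unfolding f_def explore_eps_eq using I(1)[of u] by real_asymp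
    moreover have "summable (\<lambda>k. norm (1 / real k ^ 2))"
      using inverse_power_summable[of 2, where 'a=real] by (simp add: inverse_eq_divide)
    ultimately show ?thesis by (rule summable_comparison_test_bigo[rotated])
  qed
  have f_nonneg: "0 \<le> f u k" for u k by (simp add: f_def)
  have bound: "(\<integral>\<^sup>+w. ennreal (real k) * indicator {w. CARD('u) \<le> k \<and> deviates \<eta> k w} w \<partial>P)
      \<le> ennreal (\<Sum>u\<in>UNIV. f u k)" for k
  proof (cases "CARD('u) \<le> k")
    case True
    have "(\<integral>\<^sup>+w. ennreal (real k) * indicator {w. CARD('u) \<le> k \<and> deviates \<eta> k w} w \<partial>P) =
        (\<integral>\<^sup>+w. ennreal (real k) * indicator (\<Union>u. ?A u k) w \<partial>P)"
      using True by (intro nn_integral_cong) (auto simp: indicator_def deviates_def)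
    also have "\<dots> = ennreal (real k) * emeasure P (\<Union>u. ?A u k)"
      by (intro nn_integral_cmult_indicator) measurable
    also have "\<dots> \<le> ennreal (real k) * (\<Sum>u\<in>UNIV. emeasure P (?A u k))"
      by (intro mult_left_mono emeasure_subadditive_finite) auto
    also have "\<dots> \<le> ennreal (real k) * (\<Sum>u\<in>UNIV. ennreal (2 * exp (- I u * ?m k)))"
      using forced_exploration[OF _ True] by (intro mult_left_mono sum_mono I(2)) auto
    also have "\<dots> = ennreal (\<Sum>u\<in>UNIV. f u k)"
      by (simp add: f_def sum_ennreal sum_distrib_left ennreal_mult[symmetric] sum_nonneg mult_ac)
    finally show ?thesis .
  qed (simp add: sum_nonneg f_nonneg)
  have "(\<integral>\<^sup>+w. last_deviation \<eta> w \<partial>P) =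
      (\<Sum>k. \<integral>\<^sup>+w. ennreal (real k) * indicator {w. CARD('u) \<le> k \<and> deviates \<eta> k w} w \<partial>P)"
    unfolding last_deviation_def by (intro nn_integral_suminf) measurable
  also have "\<dots> \<le> (\<Sum>k. ennreal (\<Sum>u\<in>UNIV. f u k))"
    by (intro suminf_le bound) auto
  also have "\<dots> = ennreal (\<Sum>k. \<Sum>u\<in>UNIV. f u k)"
    using \<open>\<And>u. summable (f u)\<close> by (intro suminf_ennreal2 sum_nonneg f_nonneg summable_sum)
  also have "\<dots> < \<infinity>" by simp
  finally show ?thesis .
qed

lemma expected_time_le:
  assumes \<theta>: "\<theta> \<in> \<Theta> m" and d: "0 < d" "ereal d < D_star \<theta>" and \<delta>: "0 < \<delta>" "\<delta> < d"
  obtains c where "0 \<le> c" "\<And>\<alpha>. expected_time \<alpha> \<le> ennreal ((1 + \<delta>) / (d - \<delta>) * \<bar>ln \<alpha>\<bar> + c)"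
proof -
  interpret P: prob_space P by (rule prob_space_P)
  have params: "\<theta> \<in> param_space" using \<theta> \<Theta>_subset by blast
  obtain \<eta> b where \<eta>: "0 < \<eta>" and b: "0 \<le> b" and growth:
    "\<And>w n R. w \<in> space P \<Longrightarrow> (\<And>n t. 0 < lik n w t) \<Longrightarrow> 0 \<le> R \<Longrightarrow>
      (\<And>k. CARD('u) \<le> k \<Longrightarrow> R < real k \<Longrightarrow> \<not> deviates \<eta> k w) \<Longrightarrow> b * (1 + R) \<le> real n \<Longrightarrow>
      ereal (real n * d) \<le> Z n w"
    by (rule evidence_growth[OF \<theta> d]) blast
  obtain n0 where n0: "\<And>n \<alpha>. n0 \<le> n \<Longrightarrow>
      threshold CARD('u) n \<alpha> \<le> \<delta> * real n + (1 + \<delta>) * \<bar>ln \<alpha>\<bar> + real CARD('u) / \<delta>"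
    by (rule threshold_le[OF \<delta>(1), of "CARD('u)"]) blast
  define c0 where "c0 = real CARD('u) / \<delta> / (d - \<delta>) + b + real n0 + 2"
  have c0: "0 \<le> c0" using \<delta> b by (simp add: c0_def)
  have \<tau>_le: "ennreal_of_enat (\<tau> \<alpha> w) \<le>
      ennreal ((1 + \<delta>) / (d - \<delta>) * \<bar>ln \<alpha>\<bar> + c0) + ennreal b * last_deviation \<eta> w + last_deviation \<eta> w"
    if w: "w \<in> space P" and pos: "\<forall>n t. 0 < lik n w t" for \<alpha> w
  proof (cases "last_deviation \<eta> w")
    case (real R)
    \<comment> \<open>The first terms solve \<open>n * d \<ge> \<delta> * n + (1 + \<delta>) * |ln
      \<alpha>| + K / \<delta>\<close> for \<open>n\<close>; the others make the growth and
      threshold bounds applicable, and the last 1 ensures \<open>1 \<le> n\<close>. Together with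
      the rounding it gives the 2 in \<open>c0\<close>.\<close>
    define x where "x = (1 + \<delta>) / (d - \<delta>) * \<bar>ln \<alpha>\<bar> + real CARD('u) / \<delta> / (d - \<delta>) + b * (1 + R) + real n0 + 1"
    define n where "n = nat \<lceil>x\<rceil>"
    have parts: "0 \<le> (1 + \<delta>) / (d - \<delta>) * \<bar>ln \<alpha>\<bar>" "0 \<le> real CARD('u) / \<delta> / (d - \<delta>)" "0 \<le> b * (1 + R)"
      using \<delta> b real by auto
    then have "1 \<le> x" unfolding x_def by linarith
    then have n: "x \<le> real n" "real n \<le> x + 1" by (simp_all add: n_def)
    have "1 \<le> n" "n0 \<le> n" "b * (1 + R) \<le> real n" using n(1) parts unfolding x_def by linarith+
    have "(1 + \<delta>) / (d - \<delta>) * \<bar>ln \<alpha>\<bar> + real CARD('u) / \<delta> / (d - \<delta>) \<le> real n"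
      using n(1) parts(3) unfolding x_def by linarith
    then have "((1 + \<delta>) * \<bar>ln \<alpha>\<bar> + real CARD('u) / \<delta>) / (d - \<delta>) \<le> real n"
      by (simp only: add_divide_distrib[of "(1 + \<delta>) * \<bar>ln \<alpha>\<bar>"] times_divide_eq_left)
    then have "(1 + \<delta>) * \<bar>ln \<alpha>\<bar> + real CARD('u) / \<delta> \<le> real n * (d - \<delta>)"
      using \<delta>(2) by (simp add: pos_divide_le_eq)
    then have "threshold CARD('u) n \<alpha> \<le> real n * d"
      using n0[OF \<open>n0 \<le> n\<close>, of \<alpha>] by (simp add: algebra_simps)
    moreover have "ereal (real n * d) \<le> Z n w"
    proof (rule growth[OF w _ _ _ \<open>b * (1 + R) \<le> real n\<close>])
      fix k assume "CARD('u) \<le> k" "R < real k"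
      then show "\<not> deviates \<eta> k w"
        using deviates_le_last[of k \<eta> w] real by (auto simp: ennreal_le_iff)
    qed (use pos real in auto)
    ultimately have "ereal (threshold CARD('u) n \<alpha>) \<le> Z n w" by (meson ereal_less_eq(3) order_trans)
    then have "\<tau> \<alpha> w \<le> enat n" unfolding \<tau>_def using \<open>1 \<le> n\<close> by (intro Inf_lower) blast
    then have "ennreal_of_enat (\<tau> \<alpha> w) \<le> ennreal_of_enat (enat n)" by (simp del: ennreal_of_enat_enat)
    also have "\<dots> = ennreal (real n)" by (simp add: ennreal_of_nat_eq_real_of_nat)
    also have "\<dots> \<le> ennreal (((1 + \<delta>) / (d - \<delta>) * \<bar>ln \<alpha>\<bar> + c0) + b * R + R)"
      using n(2) real by (intro ennreal_leI) (simp add: x_def c0_def algebra_simps)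
    also have "\<dots> = ennreal ((1 + \<delta>) / (d - \<delta>) * \<bar>ln \<alpha>\<bar> + c0) + ennreal b * last_deviation \<eta> w + last_deviation \<eta> w"
      using real b c0 parts by (simp add: ennreal_plus ennreal_mult)
    finally show ?thesis .
  qed simp
  define r where "r = enn2real (\<integral>\<^sup>+w. last_deviation \<eta> w \<partial>P)"
  have r: "(\<integral>\<^sup>+w. last_deviation \<eta> w \<partial>P) = ennreal r" "0 \<le> r"
    using last_deviation_integrable[OF params \<eta>] by (simp_all add: r_def)
  have "expected_time \<alpha> \<le> ennreal ((1 + \<delta>) / (d - \<delta>) * \<bar>ln \<alpha>\<bar> + (c0 + b * r + r))" for \<alpha>
  proof -
    have "expected_time \<alpha> \<le> (\<integral>\<^sup>+w. ennreal ((1 + \<delta>) / (d - \<delta>) * \<bar>ln \<alpha>\<bar> + c0)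
        + ennreal b * last_deviation \<eta> w + last_deviation \<eta> w \<partial>P)"
      unfolding expected_time_def
    proof (rule nn_integral_mono_AE)
      show "AE w in P. ennreal_of_enat (\<tau> \<alpha> w) \<le> ennreal ((1 + \<delta>) / (d - \<delta>) * \<bar>ln \<alpha>\<bar> + c0)
          + ennreal b * last_deviation \<eta> w + last_deviation \<eta> w"
        using AE_space AE_lik_pos by eventually_elim (rule \<tau>_le)
    qed
    also have "\<dots> = ennreal ((1 + \<delta>) / (d - \<delta>) * \<bar>ln \<alpha>\<bar> + c0) + ennreal b * ennreal r + ennreal r"
      by (simp add: nn_integral_add nn_integral_cmult r P.emeasure_space_1)
    also have "\<dots> = ennreal ((1 + \<delta>) / (d - \<delta>) * \<bar>ln \<alpha>\<bar> + (c0 + b * r + r))"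
      using \<delta> b c0 r by (simp add: ennreal_mult[symmetric] ennreal_plus[symmetric] add.assoc del: ennreal_plus)
    finally show ?thesis .
  qed
  moreover have "0 \<le> c0 + b * r + r" using c0 b r by simp
  ultimately show ?thesis using that by blast
qed

lemma Limsup_expected_time_le:
  assumes \<theta>: "\<theta> \<in> \<Theta> m" and d: "0 < d" "ereal d < D_star \<theta>"
  shows "Limsup (at_right 0) (\<lambda>\<alpha>. enn2ereal (expected_time \<alpha>) / ereal \<bar>ln \<alpha>\<bar>) \<le> ereal (1 / d)"
proof -
  \<comment> \<open>The gap between \<open>d\<close> and \<open>e\<close> pays for the
    \<open>\<delta>\<close> lost in the slope and for the constant, so the bound comes out as
    \<open>1 / d\<close> exactly.\<close>
  obtain e where e: "d < e" "ereal e < D_star \<theta>" using ereal_dense2[OF d(2)] by auto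
  have "((\<lambda>\<delta>. (1 + \<delta>) / (e - \<delta>)) \<longlongrightarrow> (1 + 0) / (e - 0)) (at_right 0)"
    using d e by (intro tendsto_intros) auto
  moreover have "1 / e < 1 / d" using d e by (simp add: field_simps)
  ultimately have "\<forall>\<^sub>F \<delta> in at_right 0. (1 + \<delta>) / (e - \<delta>) < 1 / d"
    by (intro order_tendstoD(2)) simp_all
  moreover have "\<forall>\<^sub>F \<delta> in at_right (0::real). \<delta> \<in> {0<..<e}" using d e by (intro eventually_at_right_real) simp
  ultimately have "\<forall>\<^sub>F \<delta> in at_right 0. (1 + \<delta>) / (e - \<delta>) < 1 / d \<and> \<delta> \<in> {0<..<e}"
    by (rule eventually_conj)
  from eventually_happens'[OF trivial_limit_at_right_real this]
  obtain \<delta> where \<delta>: "(1 + \<delta>) / (e - \<delta>) < 1 / d" "0 < \<delta>" "\<delta> < e" by auto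
  have "0 < e" using d e by simp
  obtain c where c: "0 \<le> c" "\<And>\<alpha>. expected_time \<alpha> \<le> ennreal ((1 + \<delta>) / (e - \<delta>) * \<bar>ln \<alpha>\<bar> + c)"
    by (rule expected_time_le[OF \<theta> \<open>0 < e\<close> e(2) \<delta>(2,3)]) blast
  have "((\<lambda>\<alpha>. (1 + \<delta>) / (e - \<delta>) + c / \<bar>ln \<alpha>\<bar>) \<longlongrightarrow> (1 + \<delta>) / (e - \<delta>) + 0) (at_right 0)"
    by (intro tendsto_add tendsto_const) real_asymp
  then have "\<forall>\<^sub>F \<alpha> in at_right 0. (1 + \<delta>) / (e - \<delta>) + c / \<bar>ln \<alpha>\<bar> < 1 / d"
    using \<delta>(1) by (intro order_tendstoD(2)) simp_all
  moreover have "\<forall>\<^sub>F \<alpha> in at_right (0::real). \<alpha> \<in> {0<..<1}" by (intro eventually_at_right_real) simp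
  ultimately have "\<forall>\<^sub>F \<alpha> in at_right 0. enn2ereal (expected_time \<alpha>) / ereal \<bar>ln \<alpha>\<bar> \<le> ereal (1 / d)"
  proof eventually_elim
    case (elim \<alpha>)
    then have ln: "0 < \<bar>ln \<alpha>\<bar>" by simp
    let ?x = "(1 + \<delta>) / (e - \<delta>) * \<bar>ln \<alpha>\<bar> + c"
    have "0 \<le> ?x" using c(1) \<delta> by simp
    have "enn2ereal (expected_time \<alpha>) \<le> enn2ereal (ennreal ?x)"
      using c(2)[of \<alpha>] by (simp add: less_eq_ennreal.rep_eq)
    also have "\<dots> = ereal ?x" using \<open>0 \<le> ?x\<close> by (rule enn2ereal_ennreal)
    finally have "enn2ereal (expected_time \<alpha>) / ereal \<bar>ln \<alpha>\<bar> \<le> ereal ?x / ereal \<bar>ln \<alpha>\<bar>"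
      by (intro ereal_divide_right_mono) (use ln in auto)
    also have "\<dots> = ereal ((1 + \<delta>) / (e - \<delta>) + c / \<bar>ln \<alpha>\<bar>)"
      using ln by (simp add: add_divide_distrib)
    also have "\<dots> \<le> ereal (1 / d)" using elim by simp
    finally show ?case .
  qed
  then show ?thesis by (rule Limsup_bounded)
qed

theorem Limsup_expected_time:
  assumes "\<theta> \<in> (\<Union>m. \<Theta> m)"
  shows "Limsup (at_right 0) (\<lambda>\<alpha>. enn2ereal (expected_time \<alpha>) / ereal \<bar>ln \<alpha>\<bar>) \<le> 1 / D_star \<theta>"
    (is "?L \<le> _")
proof -
  obtain m where m: "\<theta> \<in> \<Theta> m" using assms by blast
  note bound = Limsup_expected_time_le[OF m]
  note q = q_star_props[OF q_star_unique[OF assms]]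
  have "0 \<le> D_star \<theta>" using info_nonneg[OF m q(1)] q(2) by simp
  \<comment> \<open>For zero the right-hand side is \<open>\<infinity>\<close> by the convention of
    \<open>ereal\<close>; the infinite value arises only when there is no second hypothesis.
    Otherwise \<open>d\<close> increases to \<open>D\<close>.\<close>
  then consider "D_star \<theta> = 0" | "D_star \<theta> = \<infinity>" | D where "D_star \<theta> = ereal D" "0 < D"
    by (cases "D_star \<theta>") (auto simp: zero_ereal_def less_le)
  then show ?thesis
  proof cases
    case 1
    then show ?thesis by (simp add: divide_ereal_def)
  next
    case 2
    have "((\<lambda>d. ereal (1 / d)) \<longlongrightarrow> ereal 0) at_top"
      by (intro tendsto_ereal) real_asymp
    moreover have "\<forall>\<^sub>F d in at_top. ?L \<le> ereal (1 / d)"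
      using eventually_gt_at_top[of "0::real"] by eventually_elim (use 2 in \<open>auto intro!: bound\<close>)
    ultimately have "?L \<le> ereal 0" by (intro tendsto_lowerbound[of _ _ at_top]) auto
    then show ?thesis using 2 by (simp add: zero_ereal_def)
  next
    case 3
    have "((\<lambda>d. ereal (1 / d)) \<longlongrightarrow> ereal (1 / D)) (at_left D)"
      using 3 by (intro tendsto_ereal tendsto_intros) auto
    moreover have "\<forall>\<^sub>F d in at_left D. d \<in> {0<..<D}" using 3 by (intro eventually_at_left_real)
    then have "\<forall>\<^sub>F d in at_left D. ?L \<le> ereal (1 / d)"
      by eventually_elim (use 3 in \<open>auto intro!: bound\<close>)
    ultimately have "?L \<le> ereal (1 / D)" by (intro tendsto_lowerbound[of _ _ "at_left D"]) auto
    then show ?thesis using 3 by (simp add: one_ereal_def)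
  qed
qed

end

theorem theorem3:
  fixes \<mu> :: "'y measure"
    and h T :: "'u::finite \<Rightarrow> 'y \<Rightarrow> real"
    and nrm :: "real ^ 'u \<Rightarrow> real"
    and npieces :: "'m::finite \<Rightarrow> nat"
    and \<Gamma> :: "'m \<Rightarrow> nat \<Rightarrow> (real ^ 'u) set"
    and \<theta> :: "real ^ 'u"
    and P :: "'w measure"
    and U :: "nat \<Rightarrow> 'w \<Rightarrow> 'u"
    and Y :: "nat \<Rightarrow> 'w \<Rightarrow> 'y"
    and \<rho> :: real
    and q_eps :: "real \<Rightarrow> real ^ 'u \<Rightarrow> real ^ 'u"
    and mle plug_in :: "nat \<Rightarrow> 'w \<Rightarrow> real ^ 'u"
    and rec :: "nat \<Rightarrow> 'w \<Rightarrow> 'm"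
    and init :: "nat \<Rightarrow> real ^ 'u"
  assumes "proposed_policy \<mu> h T nrm npieces \<Gamma> \<theta> P U Y \<rho> q_eps mle plug_in rec init"
    and "\<theta> \<in> (\<Union>m. hypothesis_sets.\<Theta> npieces \<Gamma> m)"
  shows "Limsup (at_right 0)
           (\<lambda>\<alpha>. enn2ereal (proposed_policy.expected_time \<mu> h T npieces \<Gamma> P U Y \<alpha>) / ereal \<bar>ln \<alpha>\<bar>)
         \<le> 1 / hypothesis_sets.D_star \<mu> h T npieces \<Gamma> \<theta>"
  using proposed_policy.Limsup_expected_time[OF assms] .

end
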